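(* Let $K \subset \mathbb{R}^2$ (with the topology induced from $\mathbb{R}^2$) be the union of the rectangle $[-1,0] \times [-1,1]$ and the set $\{(x, \sin(1/x)) : 0 < x \leq 1\}$. Then $K \in \mathcal{DCP}$.
   Context: For a compact Hausdorff space $K$, let $C(K)$ be the Banach space (with the supremum norm) of all real-valued or complex-valued continuous functions on $K$. For $f \in C(K)$ the corresponding multiplication operator $F$ on $C(K)$ is $(Fx)(t) = f(t)x(t)$, $x \in C(K)$, $t \in K$. The double commutant $\{F\}^{cc}$ of $F$ is the set of all bounded linear operators on $C(K)$ that commute with every bounded linear operator on $C(K)$ commuting with $F$. $\mathcal{A}_F$ denotes the closure in the operator norm of the algebra generated by $F$ and the identity operator $I$ (for multiplication operators on $C(K)$ this is the same as the closure of that algebra in the weak or strong operator topology). The notation $K \in \mathcal{DCP}$ (double commutant property) means: for every real-valued $f \in C(K)$, with corresponding multiplication operator $F$, one has $\{F\}^{cc} = \mathcal{A}_F$. *)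

theory Defs
  imports "HOL-Analysis.Analysis"
begin

class compact_t2_space = t2_space +
  assumes compact_UNIV: "compact (UNIV :: 'a set)"

text \<open>On a compact space every continuous function is bounded, so the type of bounded
  continuous functions \<^typ>\<open>'a \<Rightarrow>\<^sub>C 'k\<close> is the space of all continuous functions with
  the supremum norm. The scalar field \<^typ>\<open>'k\<close> is intended to be \<^typ>\<open>real\<close> or
  \<^typ>\<open>complex\<close>.\<close>

definition mult_bcontfun ::
  "('a::topological_space \<Rightarrow>\<^sub>C 'k::real_normed_field) \<Rightarrow> ('a \<Rightarrow>\<^sub>C 'k) \<Rightarrow> ('a \<Rightarrow>\<^sub>C 'k)" where
  "mult_bcontfun f x = Bcontfun (\<lambda>t. f t * x t)"

definition mult_op ::
  "('a::topological_space \<Rightarrow>\<^sub>C 'k::real_normed_field) \<Rightarrow> ('a \<Rightarrow>\<^sub>C 'k) \<Rightarrow>\<^sub>L ('a \<Rightarrow>\<^sub>C 'k)" where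
  "mult_op f = Blinfun (mult_bcontfun f)"

lemma norm_mult_bcontfun_pointwise:
  "norm (apply_bcontfun f t * apply_bcontfun x t :: 'k::real_normed_field) \<le> norm f * norm x"
  by (simp add: norm_mult mult_mono norm_bounded)

lemma apply_mult_bcontfun [simp]:
  "apply_bcontfun (mult_bcontfun f x) t = f t * x t"
proof -
  have "(\<lambda>t. f t * x t) \<in> bcontfun"
    by (rule bcontfun_normI)
      (auto intro!: continuous_intros norm_mult_bcontfun_pointwise)
  then show ?thesis
    by (simp add: mult_bcontfun_def Bcontfun_inverse)
qed

lemma bounded_linear_mult_bcontfun: "bounded_linear (mult_bcontfun f)"
proof (rule bounded_linear_intro[where K = "norm f"])
  show "norm (mult_bcontfun f x) \<le> norm x * norm f" for x
    by (rule norm_bound) (simp add: norm_mult_bcontfun_pointwise mult.commute)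
qed (auto intro!: bcontfun_eqI simp: algebra_simps)

lemma apply_mult_op [simp]: "apply_bcontfun (blinfun_apply (mult_op f) x) t = f t * x t"
  by (simp add: mult_op_def bounded_linear_Blinfun_apply[OF bounded_linear_mult_bcontfun])

text \<open>Elements of \<^typ>\<open>'b \<Rightarrow>\<^sub>L 'c\<close> are only required to be linear over the reals, so
  linearity over \<^typ>\<open>'k\<close> has to be imposed separately.\<close>

definition scalar_linear ::
  "(('a::topological_space \<Rightarrow>\<^sub>C 'k::real_normed_field) \<Rightarrow>\<^sub>L ('a \<Rightarrow>\<^sub>C 'k)) \<Rightarrow> bool" where
  "scalar_linear T \<longleftrightarrow>
     (\<forall>c x. T (mult_bcontfun (const_bcontfun c) x) = mult_bcontfun (const_bcontfun c) (T x))"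

definition commutant ::
  "(('a::topological_space \<Rightarrow>\<^sub>C 'k::real_normed_field) \<Rightarrow>\<^sub>L ('a \<Rightarrow>\<^sub>C 'k)) set
    \<Rightarrow> (('a \<Rightarrow>\<^sub>C 'k) \<Rightarrow>\<^sub>L ('a \<Rightarrow>\<^sub>C 'k)) set" where
  "commutant \<S> = {S. scalar_linear S \<and> (\<forall>T\<in>\<S>. S o\<^sub>L T = T o\<^sub>L S)}"

definition double_commutant ::
  "(('a::topological_space \<Rightarrow>\<^sub>C 'k::real_normed_field) \<Rightarrow>\<^sub>L ('a \<Rightarrow>\<^sub>C 'k))
    \<Rightarrow> (('a \<Rightarrow>\<^sub>C 'k) \<Rightarrow>\<^sub>L ('a \<Rightarrow>\<^sub>C 'k)) set" where
  "double_commutant T = commutant (commutant {T})"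

text \<open>The unital algebra over \<^typ>\<open>'k\<close> generated by an operator. Scaling by \<open>c\<close> is
  composition with multiplication by the constant function \<open>c\<close>.\<close>

inductive_set generated_algebra ::
  "(('a::topological_space \<Rightarrow>\<^sub>C 'k::real_normed_field) \<Rightarrow>\<^sub>L ('a \<Rightarrow>\<^sub>C 'k))
    \<Rightarrow> (('a \<Rightarrow>\<^sub>C 'k) \<Rightarrow>\<^sub>L ('a \<Rightarrow>\<^sub>C 'k)) set"
  for T where
  generator: "T \<in> generated_algebra T"
| identity: "id_blinfun \<in> generated_algebra T"
| add: "R \<in> generated_algebra T \<Longrightarrow> S \<in> generated_algebra T \<Longrightarrow> R + S \<in> generated_algebra T"
| compose: "R \<in> generated_algebra T \<Longrightarrow> S \<in> generated_algebra T \<Longrightarrow> R o\<^sub>L S \<in> generated_algebra T"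
| scale: "R \<in> generated_algebra T \<Longrightarrow> mult_op (const_bcontfun c) o\<^sub>L R \<in> generated_algebra T"

definition closed_generated_algebra ::
  "(('a::topological_space \<Rightarrow>\<^sub>C 'k::real_normed_field) \<Rightarrow>\<^sub>L ('a \<Rightarrow>\<^sub>C 'k))
    \<Rightarrow> (('a \<Rightarrow>\<^sub>C 'k) \<Rightarrow>\<^sub>L ('a \<Rightarrow>\<^sub>C 'k)) set" where
  "closed_generated_algebra T = closure (generated_algebra T)"

definition double_commutant_property ::
  "'a::compact_t2_space itself \<Rightarrow> 'k::real_normed_field itself \<Rightarrow> bool" where
  "double_commutant_property K k \<longleftrightarrow>
     (\<forall>f :: 'a \<Rightarrow>\<^sub>C 'k. (\<forall>t. apply_bcontfun f t \<in> \<real>) \<longrightarrow>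
        double_commutant (mult_op f) = closed_generated_algebra (mult_op f))"

definition rectangle_sine_curve :: "(real \<times> real) set" where
  "rectangle_sine_curve =
     {-1..0} \<times> {-1..1} \<union> {(x, sin (1 / x)) | x. 0 < x \<and> x \<le> 1}"

typedef rectangle_sine_space = rectangle_sine_curve
  morphisms point_of Point
  by (rule exI[of _ "(0, 0)"]) (simp add: rectangle_sine_curve_def)

instantiation rectangle_sine_space :: metric_space
begin

definition dist_rectangle_sine_space :: "rectangle_sine_space \<Rightarrow> rectangle_sine_space \<Rightarrow> real" where
  "dist_rectangle_sine_space p q = dist (point_of p) (point_of q)"

definition uniformity_rectangle_sine_space ::
  "(rectangle_sine_space \<times> rectangle_sine_space) filter" where
  "uniformity_rectangle_sine_space = (INF e\<in>{0<..}. principal {(x, y). dist x y < e})"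

definition open_rectangle_sine_space :: "rectangle_sine_space set \<Rightarrow> bool" where
  "open_rectangle_sine_space U \<longleftrightarrow> (\<forall>x\<in>U. \<forall>\<^sub>F (x', y) in uniformity. x' = x \<longrightarrow> y \<in> U)"

instance
proof
  show "dist x y = 0 \<longleftrightarrow> x = y" for x y :: rectangle_sine_space
    by (simp add: dist_rectangle_sine_space_def point_of_inject)
  show "dist x y \<le> dist x z + dist y z" for x y z :: rectangle_sine_space
    by (simp add: dist_rectangle_sine_space_def dist_triangle2)
qed (rule uniformity_rectangle_sine_space_def open_rectangle_sine_space_def)+

end

lemma continuous_on_point_of: "continuous_on S point_of"
  unfolding continuous_on_iff dist_rectangle_sine_space_def by blast

lemma continuous_on_Point: "continuous_on rectangle_sine_curve Point"
  unfolding continuous_on_iff dist_rectangle_sine_space_def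
  by (auto simp: Point_inverse)

lemma open_rectangle_sine_space_iff:
  "open U \<longleftrightarrow> (\<exists>V. open V \<and> U = point_of -` V)"
proof
  assume "open U"
  then obtain V where V: "open V" "V \<inter> rectangle_sine_curve = Point -` U \<inter> rectangle_sine_curve"
    using continuous_on_Point unfolding continuous_on_open_invariant by blast
  have "p \<in> U \<longleftrightarrow> point_of p \<in> V" for p
  proof -
    have "point_of p \<in> V \<inter> rectangle_sine_curve \<longleftrightarrow>
        point_of p \<in> Point -` U \<inter> rectangle_sine_curve"
      by (simp only: V(2))
    then show ?thesis
      by (simp add: point_of point_of_inverse)
  qed
  then show "\<exists>V. open V \<and> U = point_of -` V"
    using V(1) by blast
next
  show "open U" if "\<exists>V. open V \<and> U = point_of -` V"
    using that continuous_on_point_of[of UNIV] by (auto intro: open_vimage)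
qed

lemma compact_rectangle_sine_curve: "compact rectangle_sine_curve"
proof -
  let ?W = "{p :: real \<times> real. 0 < fst p} \<inter> (\<lambda>p. snd p - sin (1 / fst p)) -` (- {0})"
  have "open {p :: real \<times> real. 0 < fst p}"
    by (intro open_Collect_less continuous_intros)
  then have W: "open ?W"
    by (intro continuous_open_preimage continuous_intros) auto
  have eq: "rectangle_sine_curve = ({-1..1} \<times> {-1..1}) \<inter> - ?W"
    by (auto simp: rectangle_sine_curve_def)
  show ?thesis
    unfolding eq
    by (rule compact_Int_closed[OF compact_Times[OF compact_Icc compact_Icc] closed_Compl[OF W]])
qed

instance rectangle_sine_space :: compact_t2_space
proof
  have "compact (Point ` rectangle_sine_curve)"
    by (intro compact_continuous_image continuous_on_Point compact_rectangle_sine_curve)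
  moreover have "Point ` rectangle_sine_curve = UNIV"
    using type_definition.Abs_image[OF type_definition_rectangle_sine_space] .
  ultimately show "compact (UNIV :: rectangle_sine_space set)"
    by simp
qed

end

theory Submission
  imports Defs
begin

text \<open>
  Write \<open>F\<close> for multiplication by the real-valued function \<open>f\<close>, and \<open>r t\<close> for the real number
  \<open>f t\<close>. An operator in the double commutant of \<open>F\<close> commutes with every multiplication operator
  and is therefore multiplication by some \<open>h\<close>. If \<open>h\<close> is constant on the level sets of \<open>r\<close>,
  then \<open>h = g \<circ> r\<close> with \<open>g\<close> continuous on the compact set \<open>range r\<close>, and polynomials that
  approximate \<open>g\<close> show that the operator lies in the closed algebra generated by \<open>F\<close>. So the
  content of the theorem is that \<open>r s = r t\<close> implies \<open>h s = h t\<close>, and this is proved by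
  exhibiting enough operators that commute with \<open>F\<close> and hence with multiplication by \<open>h\<close>.

  Two kinds of operators are used. If a level set contains a nonempty open set \<open>O\<close> (the level is a
  \<^emph>\<open>plateau\<close>) and \<open>v\<close> is any point of that level, then \<open>x \<mapsto> w \<cdot> x(v)\<close> commutes with \<open>F\<close> whenever
  \<open>w\<close> vanishes off \<open>O\<close>, which forces \<open>h\<close> to be constant on the level
  (\<open>constant_on_plateau_level\<close>). Away from plateaus the operators are
  \<open>(S x)(k) = \<integral> x d\<mu>\<close> with \<open>\<mu> = \<mu>\<^bsub>r k\<^esub>\<close>, for a weak-* continuous family of measures such that
  \<open>\<mu>\<^bsub>c\<^esub>\<close> lives on level \<open>c\<close> in the closure of a small connected set \<open>C\<close> on which \<open>r\<close> takes
  values below and above \<open>c\<close>. In the absence of plateaus a level that is crossed by \<open>C\<close> is also crossed by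
  arbitrarily small connected pieces of \<open>C\<close> (\<open>small_crossed_patch\<close>), so a bump function of
  the level can be split again and again by partitions of unity, each summand belonging to a
  smaller piece; the resulting finite combinations of point evaluations converge. This is the
  argument of Michael's selection theorem. Commutation with multiplication by \<open>h\<close> now says that
  the value of \<open>h\<close> at \<^emph>\<open>every\<close> point of level \<open>c\<close> is a limit of averages of values of \<open>h\<close>
  on \<open>C\<close> (\<open>level_transfer\<close>).

  Call \<open>X\<close> tame if it is connected, locally connected and contained in the closure of its
  interior. It follows that \<open>h\<close> agrees at any two points of a level near which \<open>r\<close> takes larger
  values on tame sets that contain them, and likewise for smaller values. If the level is not a plateau,
  every point of it in a tame set is of one of these kinds; and if both kinds occur, connectedness
  yields a point that is of both kinds. Hence \<open>h\<close> is constant on each level within a tame set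
  (\<open>constant_on_level\<close>). This applies to the rectangle and to the sine curve separately. The
  requirement on the interior is what makes the right edge of the rectangle harmless: there the whole
  space is not locally connected, but a function that is constant on a relative neighbourhood in the rectangle
  already has a plateau. Finally the rectangle meets the closure of the curve, which ties the levels of
  the two parts together (\<open>constant_on_level_glued\<close>).
\<close>

section \<open>Operators commuting with multiplication operators\<close>

lemma mult_bcontfun_commute: "mult_bcontfun x y = mult_bcontfun y x"
  by (rule bcontfun_eqI) (simp add: mult.commute)

lemma mult_bcontfun_one [simp]: "mult_bcontfun x (const_bcontfun 1) = x"
  by (rule bcontfun_eqI) simp

lemma mult_op_apply: "blinfun_apply (mult_op x) y = mult_bcontfun x y"
  by (rule bcontfun_eqI) simp

lemma scalar_linear_mult_op: "scalar_linear (mult_op x)"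
  unfolding scalar_linear_def by (auto intro!: bcontfun_eqI simp: algebra_simps)

lemma mult_op_comp: "mult_op x o\<^sub>L mult_op y = mult_op (mult_bcontfun x y)"
  by (rule blinfun_eqI, rule bcontfun_eqI) (simp add: algebra_simps)

lemma mult_op_diff: "mult_op x - mult_op y = mult_op (x - y)"
  by (rule blinfun_eqI, rule bcontfun_eqI) (simp add: algebra_simps blinfun.diff_left)

lemma norm_mult_op_le: "norm (mult_op x) \<le> norm x"
  by (rule norm_blinfun_bound)
     (auto intro!: norm_bound simp: norm_mult_bcontfun_pointwise)

lemma comp_mult_op_iff:
  "S o\<^sub>L mult_op x = mult_op x o\<^sub>L S \<longleftrightarrow>
     (\<forall>y t. apply_bcontfun (blinfun_apply S (mult_bcontfun x y)) t = x t * apply_bcontfun (blinfun_apply S y) t)"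
proof -
  have "S o\<^sub>L mult_op x = mult_op x o\<^sub>L S \<longleftrightarrow>
      (\<forall>y. blinfun_apply (S o\<^sub>L mult_op x) y = blinfun_apply (mult_op x o\<^sub>L S) y)"
    by (metis blinfun_eqI)
  also have "\<dots> \<longleftrightarrow> (\<forall>y t. apply_bcontfun (blinfun_apply (S o\<^sub>L mult_op x) y) t
      = apply_bcontfun (blinfun_apply (mult_op x o\<^sub>L S) y) t)"
    by (metis bcontfun_eqI)
  finally show ?thesis by (simp add: mult_op_apply)
qed

lemma blinfun_compose_assoc: "(R o\<^sub>L S) o\<^sub>L Q = R o\<^sub>L (S o\<^sub>L Q)"
  by (rule blinfun_eqI) simp

text \<open>Multiplication operators commute with each other, so \<open>T\<close> commutes with all of them, and
  \<open>T x = T (x \<cdot> 1) = x \<cdot> T 1\<close>.\<close>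

lemma double_commutant_eq_mult_op:
  assumes "T \<in> double_commutant (mult_op f)"
  shows "T = mult_op (blinfun_apply T (const_bcontfun 1))"
proof (rule blinfun_eqI)
  fix x
  have "mult_op x \<in> commutant {mult_op f}"
    by (simp add: commutant_def scalar_linear_mult_op mult_op_comp mult_bcontfun_commute)
  then have "T o\<^sub>L mult_op x = mult_op x o\<^sub>L T"
    using assms unfolding double_commutant_def commutant_def[of "commutant _"] by blast
  then have "blinfun_apply (T o\<^sub>L mult_op x) (const_bcontfun 1)
      = blinfun_apply (mult_op x o\<^sub>L T) (const_bcontfun 1)"
    by simp
  then show "blinfun_apply T x = blinfun_apply (mult_op (blinfun_apply T (const_bcontfun 1))) x"
    by (simp add: mult_op_apply mult_bcontfun_commute)
qed

text \<open>Commutation and linearity over the scalars are equations between expressions that are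
  continuous in the operator.\<close>

lemma closed_commutant: "closed (commutant \<S>)"
proof -
  have eq: "commutant \<S> =
     (\<Inter>c x. {S. blinfun_apply S (mult_bcontfun (const_bcontfun c) x)
              = blinfun_apply (mult_op (const_bcontfun c)) (blinfun_apply S x)})
     \<inter> (\<Inter>T\<in>\<S>. {S. S o\<^sub>L T = T o\<^sub>L S})"
    by (auto simp: commutant_def scalar_linear_def mult_op_apply)
  show ?thesis
    unfolding eq by (intro closed_Int closed_INT ballI closed_Collect_eq continuous_intros)
qed

lemma generated_algebra_subset_double_commutant:
  assumes "scalar_linear T"
  shows "generated_algebra T \<subseteq> double_commutant T"
proof
  fix R assume "R \<in> generated_algebra T"
  then show "R \<in> double_commutant T"
  proof induction
    case generator
    show ?case
      using assms by (auto simp: double_commutant_def commutant_def)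
  next
    case identity
    have "scalar_linear id_blinfun" by (simp add: scalar_linear_def)
    then show ?case
      by (auto simp: double_commutant_def commutant_def[of "commutant _"] intro!: blinfun_eqI)
  next
    case (add R S)
    have "scalar_linear (R + S)"
      using add.IH unfolding double_commutant_def commutant_def[of "commutant _"] scalar_linear_def
      by (auto simp: blinfun.add_left intro!: bcontfun_eqI simp: algebra_simps)
    then show ?case
      using add.IH unfolding double_commutant_def commutant_def[of "commutant _"]
      by (auto simp: bounded_bilinear.add_left[OF bounded_bilinear_blinfun_compose]
          bounded_bilinear.add_right[OF bounded_bilinear_blinfun_compose])
  next
    case (compose R S)
    then have RS: "scalar_linear R" "scalar_linear S"
      "\<And>Q. Q \<in> commutant {T} \<Longrightarrow> R o\<^sub>L Q = Q o\<^sub>L R" "\<And>Q. Q \<in> commutant {T} \<Longrightarrow> S o\<^sub>L Q = Q o\<^sub>L S"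
      unfolding double_commutant_def commutant_def[of "commutant _"] by auto
    have "(R o\<^sub>L S) o\<^sub>L Q = Q o\<^sub>L (R o\<^sub>L S)" if "Q \<in> commutant {T}" for Q
      using RS(3,4)[OF that] by (metis blinfun_compose_assoc)
    moreover have "scalar_linear (R o\<^sub>L S)"
      using RS(1,2) by (simp add: scalar_linear_def)
    ultimately show ?case
      unfolding double_commutant_def commutant_def[of "commutant _"] by auto
  next
    case (scale R c)
    then have R: "scalar_linear R" "\<And>Q. Q \<in> commutant {T} \<Longrightarrow> R o\<^sub>L Q = Q o\<^sub>L R"
      unfolding double_commutant_def commutant_def[of "commutant _"] by auto
    have "(mult_op (const_bcontfun c) o\<^sub>L R) o\<^sub>L Q = Q o\<^sub>L (mult_op (const_bcontfun c) o\<^sub>L R)"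
      if "Q \<in> commutant {T}" for Q
    proof -
      have "mult_op (const_bcontfun c) o\<^sub>L Q = Q o\<^sub>L mult_op (const_bcontfun c)"
        using that by (auto simp: commutant_def scalar_linear_def mult_op_apply intro!: blinfun_eqI)
      with R(2)[OF that] show ?thesis by (metis blinfun_compose_assoc)
    qed
    moreover have "scalar_linear (mult_op (const_bcontfun c) o\<^sub>L R)"
      using R(1) unfolding scalar_linear_def
      by (auto simp: mult_op_apply intro!: bcontfun_eqI simp: algebra_simps)
    ultimately show ?case
      unfolding double_commutant_def commutant_def[of "commutant _"] by auto
  qed
qed

lemma closed_generated_algebra_subset_double_commutant:
  "scalar_linear T \<Longrightarrow> closed_generated_algebra T \<subseteq> double_commutant T"
  unfolding closed_generated_algebra_def
  by (intro closure_minimal generated_algebra_subset_double_commutant)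
     (simp_all add: double_commutant_def closed_commutant)

lemma bcontfun_on_compact:
  fixes g :: "'a::compact_t2_space \<Rightarrow> 'k::metric_space"
  assumes "continuous_on UNIV g"
  shows "apply_bcontfun (Bcontfun g) = g"
  using assms compact_UNIV compact_imp_bounded compact_continuous_image
  by (subst Bcontfun_inverse) (auto simp: bcontfun_def)

text \<open>Multiplication by a polynomial in \<open>r\<close> is that polynomial in the operator \<open>F\<close>.\<close>

lemma mult_op_polynomial_in_generated_algebra:
  fixes f :: "'a::compact_t2_space \<Rightarrow>\<^sub>C 'k::real_normed_field"
  assumes f: "\<And>t. f t = of_real (r t)" and r: "continuous_on UNIV r"
  assumes "real_polynomial_function (p :: real \<Rightarrow> real)"
  shows "mult_op (Bcontfun (\<lambda>t. of_real (p (r t)))) \<in> generated_algebra (mult_op f)"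
proof -
  have cont: "continuous_on UNIV (\<lambda>t. of_real (q (r t)) :: 'k)" if "real_polynomial_function q" for q :: "real \<Rightarrow> real"
  proof -
    have "continuous_on (r ` UNIV) q"
      using continuous_on_polymonial_function[of q] that
      by (auto simp: real_polynomial_function_eq intro: continuous_on_subset)
    then show ?thesis
      by (intro continuous_on_of_real continuous_on_compose2[OF _ r]) auto
  qed
  note app = bcontfun_on_compact[OF cont]
  show ?thesis
    using assms(3)
  proof (induction p rule: real_polynomial_function.induct)
    case (linear q)
    have q: "q x = q 1 * x" for x
      using linear_scale[OF bounded_linear.linear[OF linear], of x 1] by (simp add: mult.commute)
    have "mult_op (Bcontfun (\<lambda>t. of_real (q (r t)))) = mult_op (const_bcontfun (of_real (q 1))) o\<^sub>L mult_op f"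
      unfolding mult_op_comp
      by (rule arg_cong[of _ _ mult_op], rule bcontfun_eqI)
         (metis app const_bcontfun.rep_eq apply_mult_bcontfun f linear
            of_real_mult q real_polynomial_function.intros(1))
    then show ?case
      by (simp add: generated_algebra.generator generated_algebra.scale)
  next
    case (const c)
    have "mult_op (Bcontfun (\<lambda>t. of_real c)) = mult_op (const_bcontfun (of_real c :: 'k)) o\<^sub>L (id_blinfun :: ('a \<Rightarrow>\<^sub>C 'k) \<Rightarrow>\<^sub>L _)"
      by (rule blinfun_eqI) (simp add: const_bcontfun_def)
    then show ?case
      by (metis generated_algebra.identity generated_algebra.scale)
  next
    case (add p q)
    have "mult_op (Bcontfun (\<lambda>t. of_real (p (r t) + q (r t))))
        = mult_op (Bcontfun (\<lambda>t. of_real (p (r t)) :: 'k)) + mult_op (Bcontfun (\<lambda>t. of_real (q (r t))))"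
      using app[OF add.hyps(1)] app[OF add.hyps(2)]
        app[OF real_polynomial_function.intros(3)[OF add.hyps]]
      by (auto intro!: blinfun_eqI bcontfun_eqI simp: blinfun.add_left algebra_simps)
    then show ?case
      using add.IH by (simp add: generated_algebra.add)
  next
    case (mult p q)
    have "mult_op (Bcontfun (\<lambda>t. of_real (p (r t) * q (r t))))
        = mult_op (Bcontfun (\<lambda>t. of_real (p (r t)) :: 'k)) o\<^sub>L mult_op (Bcontfun (\<lambda>t. of_real (q (r t))))"
      using app[OF mult.hyps(1)] app[OF mult.hyps(2)]
        app[OF real_polynomial_function.intros(4)[OF mult.hyps]]
      by (auto intro!: blinfun_eqI bcontfun_eqI simp: algebra_simps)
    then show ?case
      using mult.IH by (simp add: generated_algebra.compose)
  qed
qed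

lemma sum_bcontfun_apply: "apply_bcontfun (\<Sum>i\<in>I. g i) t = (\<Sum>i\<in>I. apply_bcontfun (g i) t)"
  for g :: "'i \<Rightarrow> 'a::topological_space \<Rightarrow>\<^sub>C 'b::real_normed_vector"
  by (induction I rule: infinite_finite_induct) simp_all

lemma sum_in_generated_algebra:
  fixes T :: "('a::topological_space \<Rightarrow>\<^sub>C 'k::real_normed_field) \<Rightarrow>\<^sub>L ('a \<Rightarrow>\<^sub>C 'k)"
  assumes "\<And>i. i \<in> I \<Longrightarrow> R i \<in> generated_algebra T"
  shows "(\<Sum>i\<in>I. R i) \<in> generated_algebra T"
proof -
  have "mult_op (const_bcontfun 0) o\<^sub>L id_blinfun = (0 :: ('a \<Rightarrow>\<^sub>C 'k) \<Rightarrow>\<^sub>L _)"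
    by (auto intro!: blinfun_eqI bcontfun_eqI)
  then have "0 \<in> generated_algebra T"
    by (metis generated_algebra.identity generated_algebra.scale)
  then show ?thesis
    using assms by (induction I rule: infinite_finite_induct) (auto intro: generated_algebra.add)
qed

text \<open>The approximation theorem supplies polynomials with coefficients in \<open>'k\<close>. Their real
  coordinates with respect to the basis of \<open>'k\<close> reduce them to real polynomials.\<close>

lemma mult_op_vector_polynomial_in_generated_algebra:
  fixes f :: "'a::compact_t2_space \<Rightarrow>\<^sub>C 'k::{real_normed_field, euclidean_space}"
  assumes f: "\<And>t. f t = of_real (r t)" and r: "continuous_on UNIV r"
    and p: "polynomial_function (p :: real \<Rightarrow> 'k)"
  shows "mult_op (Bcontfun (\<lambda>t. p (r t))) \<in> generated_algebra (mult_op f)"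
proof -
  define q where "q b x = p x \<bullet> b" for b x
  have q: "real_polynomial_function (q b)" for b
    using p bounded_linear_inner_left[of b] unfolding polynomial_function_def q_def comp_def by blast
  have cont_poly: "continuous_on UNIV (\<lambda>t. g (r t))" if "polynomial_function g" for g :: "real \<Rightarrow> 'c::euclidean_space"
    by (rule continuous_on_compose2[OF continuous_on_polymonial_function[OF that, of UNIV] r]) simp
  have app: "apply_bcontfun (Bcontfun (\<lambda>t. of_real (q b (r t)) :: 'k)) t = of_real (q b (r t))" for b t
  proof -
    have "continuous_on UNIV (\<lambda>t. of_real (q b (r t)) :: 'k)"
      using q[of b] by (intro continuous_on_of_real cont_poly) (simp add: real_polynomial_function_eq)
    from bcontfun_on_compact[OF this] show ?thesis by simp
  qed
  have appp: "apply_bcontfun (Bcontfun (\<lambda>t. p (r t))) t = p (r t)" for t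
    using bcontfun_on_compact[OF cont_poly[OF p]] by simp
  have "mult_op (Bcontfun (\<lambda>t. p (r t)))
      = (\<Sum>b\<in>Basis. mult_op (const_bcontfun b) o\<^sub>L mult_op (Bcontfun (\<lambda>t. of_real (q b (r t)))))"
    (is "_ = ?R")
  proof (rule blinfun_eqI, rule bcontfun_eqI)
    fix x t
    have "apply_bcontfun (blinfun_apply ?R x) t = (\<Sum>b\<in>Basis. b * (of_real (q b (r t)) * x t))"
      by (simp add: blinfun.sum_left sum_bcontfun_apply app)
    also have "\<dots> = (\<Sum>b\<in>Basis. (p (r t) \<bullet> b) *\<^sub>R b) * x t"
      unfolding sum_distrib_right by (simp add: q_def scaleR_conv_of_real mult_ac)
    also have "\<dots> = p (r t) * x t" by (simp add: euclidean_representation)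
    finally show "apply_bcontfun (blinfun_apply (mult_op (Bcontfun (\<lambda>t. p (r t)))) x) t
        = apply_bcontfun (blinfun_apply ?R x) t" by (simp add: appp)
  qed
  moreover have "?R \<in> generated_algebra (mult_op f)"
    by (intro sum_in_generated_algebra generated_algebra.scale
        mult_op_polynomial_in_generated_algebra[OF f r q])
  ultimately show ?thesis by simp
qed

text \<open>A continuous map from a compact space onto a Hausdorff space is closed, hence a quotient map.\<close>

lemma factor_through_levels:
  fixes r :: "'a::compact_t2_space \<Rightarrow> real" and h :: "'a \<Rightarrow> 'b::t2_space"
  assumes r: "continuous_on UNIV r" and h: "continuous_on UNIV h" and const: "\<And>s t. r s = r t \<Longrightarrow> h s = h t"
  obtains g where "continuous_on (range r) g" "\<forall>t. h t = g (r t)"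
proof -
  define g where "g c = h (SOME t. r t = c)" for c
  have g: "h t = g (r t)" for t
    unfolding g_def by (rule const) (rule someI[of "\<lambda>s. r s = r t" t, symmetric], simp)
  have "closed (range r)"
    by (intro compact_imp_closed compact_continuous_image r compact_UNIV)
  moreover have "closed (g -` B \<inter> range r)" if "closed B" for B
  proof -
    have "compact (h -` B)"
      using compact_Int_closed[OF compact_UNIV closed_vimage[OF that h]] by simp
    then have "closed (r ` (h -` B))"
      by (intro compact_imp_closed compact_continuous_image continuous_on_subset[OF r]) auto
    moreover have "g -` B \<inter> range r = r ` (h -` B)" by (auto simp: g)
    ultimately show ?thesis by simp
  qed
  ultimately have "continuous_on (range r) g" by (subst continuous_on_closed_vimage) auto
  then show thesis by (rule that) (simp add: g)
qed

section \<open>Patches and the levels they cross\<close>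

text \<open>The hypotheses on a part of the space that make levels tractable. The third one says that every
  nonempty relatively open subset of \<open>X\<close> contains a nonempty open set of the whole space, so that
  a function constant on the former has a plateau.\<close>

definition tame :: "'a::metric_space set \<Rightarrow> bool" where
  "tame X \<longleftrightarrow> connected X \<and> locally connected X \<and> X \<subseteq> closure (interior X)"

text \<open>Patches play the role that subintervals play for functions on an interval.\<close>

definition patch :: "'a::topological_space set \<Rightarrow> 'a set \<Rightarrow> bool" where
  "patch X C \<longleftrightarrow> openin (top_of_set X) C \<and> connected C \<and> C \<noteq> {}"

definition crossed :: "('a \<Rightarrow> real) \<Rightarrow> 'a set \<Rightarrow> real set" where
  "crossed r C = {c. \<exists>p\<in>C. \<exists>q\<in>C. r p < c \<and> c < r q}"

definition plateau :: "('a::topological_space \<Rightarrow> real) \<Rightarrow> real \<Rightarrow> bool" where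
  "plateau r c \<longleftrightarrow> interior {k. r k = c} \<noteq> {}"

lemma open_crossed: "open (crossed r C)"
proof -
  have "crossed r C = (\<Union>p\<in>C. \<Union>q\<in>C. {r p<..<r q})"
    by (auto simp: crossed_def)
  then show ?thesis by (auto intro!: open_UN)
qed

lemma patch_self: "tame X \<Longrightarrow> X \<noteq> {} \<Longrightarrow> patch X X"
  by (simp add: patch_def tame_def)

lemma patch_subset: "patch X C \<Longrightarrow> C \<subseteq> X"
  by (auto simp: patch_def dest: openin_imp_subset)

lemma crossed_subset_image:
  assumes "connected C" "continuous_on C r"
  shows "crossed r C \<subseteq> r ` C"
proof
  fix c assume "c \<in> crossed r C"
  then obtain p q where pq: "p \<in> C" "q \<in> C" "r p < c" "c < r q" by (auto simp: crossed_def)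
  have "connected (r ` C)" using assms by (rule connected_continuous_image[rotated])
  then show "c \<in> r ` C"
    using pq connectedD_interval[of "r ` C" "r p" "r q" c] by auto
qed

lemma patch_nbhd:
  assumes "tame X" "patch X C" "e \<in> C" "open O'" "e \<in> O'"
  obtains D where "patch X D" "e \<in> D" "D \<subseteq> C \<inter> O'"
proof -
  have "openin (top_of_set X) (C \<inter> O')"
    using assms(2,4) by (metis patch_def openin_Int_open)
  then obtain D where "openin (top_of_set X) D" "connected D" "e \<in> D" "D \<subseteq> C \<inter> O'"
    using assms(1,3,5) unfolding tame_def locally_connected by (metis IntI)
  then show thesis
    using that by (auto simp: patch_def)
qed

lemma patch_not_level:
  assumes "tame X" "patch X C" "\<not> plateau r c"
  shows "\<exists>k\<in>C. r k \<noteq> c"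
proof (rule ccontr)
  assume "\<not> ?thesis"
  then have lev: "C \<subseteq> {k. r k = c}" by auto
  obtain V where V: "open V" "C = X \<inter> V"
    using assms(2) by (auto simp: patch_def openin_open)
  obtain e where e: "e \<in> X" "e \<in> V"
    using assms(2) V by (auto simp: patch_def)
  then have "e \<in> closure (interior X)" using assms(1) by (auto simp: tame_def)
  then obtain k where k: "k \<in> interior X" "k \<in> V"
    using e V(1) by (metis IntE disjoint_iff open_Int_closure_eq_empty)
  then have "k \<in> interior X \<inter> V" "open (interior X \<inter> V)" "interior X \<inter> V \<subseteq> {k. r k = c}"
    using V lev interior_subset by auto
  then have "k \<in> interior {k. r k = c}"
    by (metis interiorI)
  then show False using assms(3) by (auto simp: plateau_def)
qed

text \<open>A point outside both closures has a patch around it on which \<open>r\<close> has the constant value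
  \<open>c\<close>, and by tameness such a patch contains an open set of the whole space.\<close>

lemma nonplateau_one_sided:
  fixes r :: "'a::metric_space \<Rightarrow> real"
  assumes X: "tame X" and C: "patch X C" and c: "\<not> plateau r c"
  shows "C \<subseteq> closure {k\<in>C. r k < c} \<union> closure {k\<in>C. c < r k}" (is "_ \<subseteq> ?A \<union> ?B")
proof (rule ccontr)
  assume "\<not> ?thesis"
  then obtain e where e: "e \<in> C" "e \<in> - (?A \<union> ?B)" by blast
  have "open (- (?A \<union> ?B))" by (intro open_Compl closed_Un closed_closure)
  from patch_nbhd[OF X C e(1) this e(2)]
  obtain D where D: "patch X D" "e \<in> D" "D \<subseteq> C \<inter> - (?A \<union> ?B)" .
  obtain k where k: "k \<in> D" "r k \<noteq> c" using patch_not_level[OF X D(1) c] by blast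
  with D(3) have "k \<in> C" "k \<notin> ?A" "k \<notin> ?B" by auto
  moreover have "k \<in> ?A" if "k \<in> C" "r k < c" using that by (intro subsetD[OF closure_subset]) simp
  moreover have "k \<in> ?B" if "k \<in> C" "c < r k" using that by (intro subsetD[OF closure_subset]) simp
  ultimately show False
    using k(2) by linarith
qed

text \<open>The limits of points with values below \<open>c\<close> and the limits of points with values above \<open>c\<close>
  cover \<open>C\<close>, because the level is not a plateau. Without a common point in \<open>C\<close> they would
  separate this connected set.\<close>

lemma two_sided_point:
  fixes r :: "'a::metric_space \<Rightarrow> real"
  assumes X: "tame X" and C: "patch X C" and r: "continuous_on UNIV r"
    and c: "\<not> plateau r c"
    and lo: "p \<in> C" "p \<in> closure {k\<in>C. r k < c}" and hi: "q \<in> C" "q \<in> closure {k\<in>C. c < r k}"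
  obtains e where "e \<in> C" "r e = c" "e \<in> closure {k\<in>C. r k < c}" "e \<in> closure {k\<in>C. c < r k}"
proof -
  let ?A = "closure {k\<in>C. r k < c}" and ?B = "closure {k\<in>C. c < r k}"
  have "closed {k. r k \<le> c}" "closed {k. c \<le> r k}"
    by (intro closed_Collect_le r continuous_on_const)+
  then have AB: "?A \<subseteq> {k. r k \<le> c}" "?B \<subseteq> {k. c \<le> r k}"
    by (intro closure_minimal; auto)+
  have sides: "C \<subseteq> ?A \<union> ?B" by (rule nonplateau_one_sided[OF X C c])
  have "?A \<inter> ?B \<inter> C \<noteq> {}"
  proof
    assume "?A \<inter> ?B \<inter> C = {}"
    then have "?A \<inter> C = {} \<or> ?B \<inter> C = {}"
      using C sides by (intro connected_closedD) (simp_all add: patch_def)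
    then show False using lo hi by blast
  qed
  then obtain e where e: "e \<in> C" "e \<in> ?A" "e \<in> ?B" by blast
  then have "r e \<le> c" "c \<le> r e" using AB by auto
  with e show thesis by (intro that[of e]) auto
qed

lemma crossed_of_two_sided:
  assumes "e \<in> closure {k\<in>C. r k < c}" "e \<in> closure {k\<in>C. c < r k}" "open V" "e \<in> V" "V \<inter> C \<subseteq> D"
  shows "c \<in> crossed r D"
proof -
  have "V \<inter> {k\<in>C. r k < c} \<noteq> {}"
    using open_Int_closure_eq_empty[OF assms(3), of "{k\<in>C. r k < c}"] assms(1,4) by (metis IntI empty_iff)
  moreover have "V \<inter> {k\<in>C. c < r k} \<noteq> {}"
    using open_Int_closure_eq_empty[OF assms(3), of "{k\<in>C. c < r k}"] assms(2,4) by (metis IntI empty_iff)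
  ultimately obtain p q where "p \<in> V \<inter> C" "r p < c" "q \<in> V \<inter> C" "c < r q" by auto
  moreover from this have "p \<in> D" "q \<in> D" using assms(5) by auto
  ultimately show ?thesis unfolding crossed_def by blast
qed

text \<open>Every small patch around a point that is two-sided in \<open>C\<close> crosses its level.\<close>

lemma small_crossed_patch:
  fixes r :: "'a::metric_space \<Rightarrow> real"
  assumes X: "tame X" and C: "patch X C" and r: "continuous_on UNIV r"
    and c: "\<not> plateau r c" "c \<in> crossed r C" and \<epsilon>: "0 < \<epsilon>"
  obtains D where "patch X D" "D \<subseteq> C" "\<forall>p\<in>D. \<forall>q\<in>D. dist p q \<le> \<epsilon>" "c \<in> crossed r D"
proof -
  obtain p q where pq: "p \<in> C" "q \<in> C" "r p < c" "c < r q" using c(2) by (auto simp: crossed_def)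
  obtain e where e: "e \<in> C" "r e = c" "e \<in> closure {k\<in>C. r k < c}" "e \<in> closure {k\<in>C. c < r k}"
  proof (rule two_sided_point[OF X C r c(1)])
    show "p \<in> C" "q \<in> C" by (fact pq)+
    show "p \<in> closure {k\<in>C. r k < c}" "q \<in> closure {k\<in>C. c < r k}"
      by (rule subsetD[OF closure_subset], simp add: pq)+
  qed
  obtain D where D: "patch X D" "e \<in> D" "D \<subseteq> C \<inter> ball e (\<epsilon>/2)"
    by (rule patch_nbhd[OF X C e(1) open_ball, of e "\<epsilon>/2"]) (use \<epsilon> in simp)
  have "dist p q \<le> \<epsilon>" if "p \<in> D" "q \<in> D" for p q
  proof -
    have "dist e p < \<epsilon>/2" "dist e q < \<epsilon>/2" using that D(3) by auto
    then show ?thesis using dist_triangle3[of p q e] by simp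
  qed
  moreover have "c \<in> crossed r D"
  proof -
    obtain V where V: "open V" "D = X \<inter> V" using D(1) by (auto simp: patch_def openin_open)
    show ?thesis
      using crossed_of_two_sided[OF e(3,4) V(1), of D] D(2) V(2) patch_subset[OF C] by auto
  qed
  moreover have "D \<subseteq> C" using D(3) by auto
  ultimately show thesis using D(1) by (intro that[of D]) auto
qed

section \<open>Splitting a weight over small patches\<close>

text \<open>The differences \<open>ramp (s - j) - ramp (s - (j + 1))\<close> are hat functions, supported on
  \<open>[j, j + 2]\<close>; as a telescoping family they form a partition of unity.\<close>

definition ramp :: "real \<Rightarrow> real" where
  "ramp s = max 0 (min 1 s)"

lemma continuous_on_ramp [continuous_intros]:
  "continuous_on S g \<Longrightarrow> continuous_on S (\<lambda>x. ramp (g x))"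
  unfolding ramp_def by (intro continuous_intros)

lemma ramp_mono: "s \<le> t \<Longrightarrow> ramp s \<le> ramp t"
  by (auto simp: ramp_def)

lemma ramp_low: "s \<le> 0 \<Longrightarrow> ramp s = 0" and ramp_high: "1 \<le> s \<Longrightarrow> ramp s = 1"
  by (auto simp: ramp_def)

lemma sum_list_ramp:
  assumes "1 \<le> s" "s \<le> real n"
  shows "(\<Sum>j\<leftarrow>[0..<n]. ramp (s - real j) - ramp (s - real (Suc j))) = 1"
proof -
  have "(\<Sum>j\<leftarrow>[0..<m]. ramp (s - real j) - ramp (s - real (Suc j))) = ramp s - ramp (s - real m)" for m
    by (induction m) auto
  then show ?thesis using assms by (simp add: ramp_low ramp_high)
qed

type_synonym 'a piece = "(real \<Rightarrow> real) \<times> 'a set"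

text \<open>A piece \<open>(\<rho>, C)\<close> stands for the family of measures of mass \<open>\<rho> c\<close> placed somewhere
  in \<open>C\<close>. The compact support keeps \<open>\<rho>\<close> away from the ends of the range of levels crossed
  by \<open>C\<close>, so that \<open>\<rho>\<close> can be split further by finitely many functions; the absence of plateaus
  provides the small patches for that.\<close>

definition supported_piece :: "('a::metric_space \<Rightarrow> real) \<Rightarrow> 'a set \<Rightarrow> 'a piece \<Rightarrow> bool" where
  "supported_piece r X = (\<lambda>(\<rho>, C). continuous_on UNIV \<rho> \<and> (\<forall>c. 0 \<le> \<rho> c) \<and> patch X C \<and>
     (\<exists>S. compact S \<and> S \<subseteq> crossed r C \<and> (\<forall>c\<in>S. \<not> plateau r c) \<and> (\<forall>c. c \<notin> S \<longrightarrow> \<rho> c = 0)))"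

definition mesh_le :: "real \<Rightarrow> 'a::metric_space piece list \<Rightarrow> bool" where
  "mesh_le \<epsilon> L \<longleftrightarrow> (\<forall>(\<rho>, C)\<in>set L. \<forall>p\<in>C. \<forall>q\<in>C. dist p q \<le> \<epsilon>)"

text \<open>Passing to a refinement replaces each piece by pieces with smaller sets and the same total
  weight. Testing against all monotone set functions \<open>G\<close> expresses this without recording which
  piece comes from which, and makes transitivity immediate.\<close>

definition refines :: "'a piece list \<Rightarrow> 'a piece list \<Rightarrow> bool" where
  "refines L' L \<longleftrightarrow>
     (\<forall>G :: 'a set \<Rightarrow> real. (\<forall>A B. A \<noteq> {} \<longrightarrow> A \<subseteq> B \<longrightarrow> G A \<le> G B) \<longrightarrow>
        (\<forall>c. (\<Sum>(\<rho>, C)\<leftarrow>L'. \<rho> c * G C) \<le> (\<Sum>(\<rho>, C)\<leftarrow>L. \<rho> c * G C)))"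

text \<open>The levels in the support are covered by the open sets of levels that are crossed by small
  patches. Hat functions narrower than a Lebesgue number of this cover split \<open>\<rho>\<close>.\<close>

lemma split_piece:
  fixes r :: "'a::metric_space \<Rightarrow> real"
  assumes X: "tame X" and r: "continuous_on UNIV r" and \<epsilon>: "0 < \<epsilon>"
    and pc: "supported_piece r X (\<rho>, C)"
  obtains L where "\<forall>P\<in>set L. supported_piece r X P" "mesh_le \<epsilon> L" "\<forall>P\<in>set L. snd P \<subseteq> C"
    "\<And>c. (\<Sum>P\<leftarrow>L. fst P c) = \<rho> c"
proof -
  obtain S where S: "compact S" "S \<subseteq> crossed r C" "\<And>c. c \<in> S \<Longrightarrow> \<not> plateau r c" "\<And>c. c \<notin> S \<Longrightarrow> \<rho> c = 0"
    and \<rho>: "continuous_on UNIV \<rho>" "\<And>c. 0 \<le> \<rho> c" and C: "patch X C"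
    using pc unfolding supported_piece_def prod.case by metis
  show thesis
  proof (cases "S = {}")
    case True
    then show thesis using S(4) by (intro that[of "[]"]) (auto simp: mesh_le_def)
  next
    case False
    define \<D> where "\<D> = {D. patch X D \<and> D \<subseteq> C \<and> (\<forall>p\<in>D. \<forall>q\<in>D. dist p q \<le> \<epsilon>)}"
    have cov: "\<exists>D\<in>\<D>. c \<in> crossed r D" if cS: "c \<in> S" for c
    proof -
      have "c \<in> crossed r C" using cS S(2) by auto
      obtain D where "patch X D" "D \<subseteq> C" "\<forall>p\<in>D. \<forall>q\<in>D. dist p q \<le> \<epsilon>" "c \<in> crossed r D"
        by (rule small_crossed_patch[OF X C r S(3)[OF cS] \<open>c \<in> crossed r C\<close> \<epsilon>])
      then show ?thesis by (intro bexI[of _ D]) (auto simp: \<D>_def)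
    qed
    have ne: "crossed r ` \<D> \<noteq> {}" using False cov by auto
    have cover: "S \<subseteq> \<Union> (crossed r ` \<D>)" using cov by auto
    have op: "open B" if "B \<in> crossed r ` \<D>" for B using that open_crossed by auto
    have "\<exists>\<delta>>0. \<forall>T\<subseteq>S. diameter T < \<delta> \<longrightarrow> (\<exists>B\<in>crossed r ` \<D>. T \<subseteq> B)"
      by (rule Lebesgue_number_lemma[OF S(1) ne cover op]) blast+
    then obtain \<delta> where \<delta>: "0 < \<delta>" "\<And>T. T \<subseteq> S \<Longrightarrow> diameter T < \<delta> \<Longrightarrow> \<exists>B\<in>crossed r ` \<D>. T \<subseteq> B"
      by blast
    \<comment> \<open>A hat function has support of width \<open>2 * d\<close>, which has to be smaller than the Lebesgue number.\<close>
    define d where "d = \<delta> / 3"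
    have d: "0 < d" using \<delta>(1) by (simp add: d_def)
    obtain a where a: "\<And>c. c \<in> S \<Longrightarrow> \<bar>c\<bar> \<le> a"
      using compact_imp_bounded[OF S(1)] unfolding bounded_real by blast
    \<comment> \<open>The levels are rescaled so that hats have unit steps; the summand \<open>1\<close> makes the family sum to
      one already at the left end of the support.\<close>
    define s where "s c = (c + a) / d + 1" for c
    obtain n where n: "2 * a / d + 1 \<le> real n" using real_arch_simple by blast
    have s: "1 \<le> s c" "s c \<le> real n" if "c \<in> S" for c
    proof -
      have "0 \<le> c + a" "c + a \<le> 2 * a" using a[OF that] by auto
      then show "1 \<le> s c" "s c \<le> real n"
        using d n divide_right_mono[of "c + a" "2 * a" d] by (auto simp: s_def)
    qed
    define hat where "hat j c = ramp (s c - real j) - ramp (s c - real (Suc j))" for j c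
    have hat_pos: "0 \<le> hat j c" for j c by (simp add: hat_def ramp_mono)
    have hat_supp: "real j \<le> s c \<and> s c \<le> real j + 2" if "hat j c \<noteq> 0" for j c
    proof (rule ccontr)
      assume "\<not> ?thesis"
      then have "s c \<le> real j \<or> real j + 2 \<le> s c" by auto
      then have "hat j c = 0" by (auto simp: hat_def ramp_low ramp_high)
      with that show False by simp
    qed
    have cont_hat: "continuous_on UNIV (hat j)" for j
      unfolding hat_def s_def using d by (intro continuous_intros) auto
    define T where "T j = S \<inter> s -` {real j..real j + 2}" for j
    have cont_s: "continuous_on UNIV s" unfolding s_def using d by (intro continuous_intros) auto
    have T_compact: "compact (T j)" for j
      unfolding T_def by (intro compact_Int_closed S(1) closed_vimage closed_atLeastAtMost cont_s)
    have "\<exists>D\<in>\<D>. T j \<subseteq> crossed r D" for j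
    proof -
      have "diameter (T j) \<le> 2 * d"
      proof (rule diameter_le)
        fix x y assume "x \<in> T j" "y \<in> T j"
        then have "\<bar>s x - s y\<bar> \<le> 2" by (auto simp: T_def)
        moreover have "s x - s y = (x - y) / d" by (simp add: s_def diff_divide_distrib add_divide_distrib)
        ultimately show "norm (x - y) \<le> 2 * d"
          using d by (simp add: abs_divide pos_divide_le_eq)
      qed (use d in auto)
      also have "\<dots> < \<delta>" using \<delta>(1) by (simp add: d_def)
      finally show ?thesis using \<delta>(2)[of "T j"] by (auto simp: T_def)
    qed
    then obtain D where D: "\<And>j. D j \<in> \<D>" "\<And>j. T j \<subseteq> crossed r (D j)" by metis
    define L where "L = map (\<lambda>j. (\<lambda>c. \<rho> c * hat j c, D j)) [0..<n]"
    show thesis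
    proof
      have "supported_piece r X (\<lambda>c. \<rho> c * hat j c, D j)" for j
      proof -
        have "continuous_on UNIV (\<lambda>c. \<rho> c * hat j c)"
          by (intro continuous_intros \<rho>(1) cont_hat)
        moreover have "\<rho> c * hat j c = 0" if "c \<notin> T j" for c
          using that S(4)[of c] hat_supp[of j c] by (auto simp: T_def)
        moreover have "patch X (D j)" using D(1)[of j] by (auto simp: \<D>_def)
        ultimately show ?thesis
          unfolding supported_piece_def prod.case using T_compact[of j] D(2)[of j] S(3) \<rho>(2) hat_pos
          by (intro conjI exI[of _ "T j"]) (auto simp: T_def)
      qed
      then show "\<forall>P\<in>set L. supported_piece r X P" by (auto simp: L_def)
      show "mesh_le \<epsilon> L" using D(1) by (force simp: L_def mesh_le_def \<D>_def)
      show "\<forall>P\<in>set L. snd P \<subseteq> C" using D(1) by (auto simp: L_def \<D>_def)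
      show "(\<Sum>P\<leftarrow>L. fst P c) = \<rho> c" for c
      proof -
        have "(\<Sum>P\<leftarrow>L. fst P c) = \<rho> c * (\<Sum>j\<leftarrow>[0..<n]. hat j c)"
          by (simp add: L_def o_def sum_list_const_mult)
        also have "\<dots> = \<rho> c"
          using S(4)[of c] sum_list_ramp[OF s[of c]] by (cases "c \<in> S") (auto simp: hat_def)
        finally show ?thesis .
      qed
    qed
  qed
qed

lemma refine_pieces:
  fixes r :: "'a::metric_space \<Rightarrow> real"
  assumes X: "tame X" and r: "continuous_on UNIV r" and \<epsilon>: "0 < \<epsilon>"
    and L: "\<forall>P\<in>set L. supported_piece r X P \<and> snd P \<subseteq> C0"
  shows "\<exists>L'. (\<forall>P\<in>set L'. supported_piece r X P \<and> snd P \<subseteq> C0) \<and> mesh_le \<epsilon> L' \<and> refines L' L"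
  using L
proof (induction L)
  case Nil
  show ?case by (rule exI[of _ "[]"]) (simp add: mesh_le_def refines_def)
next
  case (Cons P L)
  obtain \<rho> C where P: "P = (\<rho>, C)" by (cases P)
  obtain L1 where L1: "\<forall>P\<in>set L1. supported_piece r X P \<and> snd P \<subseteq> C0" "mesh_le \<epsilon> L1" "refines L1 L"
    using Cons.IH Cons.prems by auto
  have pc: "supported_piece r X (\<rho>, C)" "C \<subseteq> C0" using Cons.prems P by auto
  obtain L2 where L2: "\<forall>P\<in>set L2. supported_piece r X P" "mesh_le \<epsilon> L2" "\<forall>P\<in>set L2. snd P \<subseteq> C"
    "\<And>c. (\<Sum>P\<leftarrow>L2. fst P c) = \<rho> c"
    using split_piece[OF X r \<epsilon> pc(1)] by metis
  have "(\<Sum>(\<rho>, C)\<leftarrow>L2. \<rho> c * G C) \<le> \<rho> c * G C"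
    if G: "\<And>A B. A \<noteq> {} \<Longrightarrow> A \<subseteq> B \<Longrightarrow> G A \<le> G B" for G :: "'a set \<Rightarrow> real" and c
  proof -
    have "(\<Sum>(\<rho>, C)\<leftarrow>L2. \<rho> c * G C) \<le> (\<Sum>P\<leftarrow>L2. fst P c * G C)"
    proof (intro sum_list_mono, clarify)
      fix \<rho>' C' assume "(\<rho>', C') \<in> set L2"
      then have "supported_piece r X (\<rho>', C')" "C' \<subseteq> C" using L2(1,3) by force+
      then show "\<rho>' c * G C' \<le> fst (\<rho>', C') c * G C"
        using G[of C' C] by (auto simp: supported_piece_def patch_def intro: mult_left_mono)
    qed
    also have "\<dots> = \<rho> c * G C" by (simp add: sum_list_mult_const L2(4))
    finally show ?thesis .
  qed
  then have "refines (L2 @ L1) (P # L)"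
    using L1(3) by (auto simp: refines_def P intro!: add_mono)
  moreover have "mesh_le \<epsilon> (L2 @ L1)" using L1(2) L2(2) by (auto simp: mesh_le_def)
  moreover have "\<forall>P\<in>set (L2 @ L1). supported_piece r X P \<and> snd P \<subseteq> C0"
    using L1(1) L2(1,3) pc(2) by (metis Un_iff order_trans set_append)
  ultimately show ?case by blast
qed

lemma refines_refl: "refines L L"
  by (simp add: refines_def)

lemma refines_trans: "refines L'' L' \<Longrightarrow> refines L' L \<Longrightarrow> refines L'' L"
  unfolding refines_def by (meson order_trans)

text \<open>Test against the constant functions \<open>1\<close> and \<open>-1\<close>.\<close>

lemma refines_sum_weights:
  fixes L L' :: "'a piece list"
  assumes "refines L' L"
  shows "(\<Sum>(\<rho>, C)\<leftarrow>L'. \<rho> c) = (\<Sum>(\<rho>, C)\<leftarrow>L. \<rho> c)"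
proof (rule antisym)
  show "(\<Sum>(\<rho>, C)\<leftarrow>L'. \<rho> c) \<le> (\<Sum>(\<rho>, C)\<leftarrow>L. \<rho> c)"
    using assms[unfolded refines_def, rule_format, of "\<lambda>_. 1" c] by simp
  have neg: "(\<Sum>(\<rho>, C)\<leftarrow>L. \<rho> c * - 1) = - (\<Sum>(\<rho>, C)\<leftarrow>L. \<rho> c)" for L :: "'a piece list"
    by (induction L) auto
  show "(\<Sum>(\<rho>, C)\<leftarrow>L. \<rho> c) \<le> (\<Sum>(\<rho>, C)\<leftarrow>L'. \<rho> c)"
    using assms[unfolded refines_def, rule_format, of "\<lambda>_. - 1" c] unfolding neg by simp
qed

section \<open>Operators as limits of weighted point evaluations\<close>

text \<open>Approximating operators converge only strongly, not in norm, so the limit operator is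
  constructed value by value.\<close>

lemma limit_operator:
  fixes \<Phi> :: "nat \<Rightarrow> ('a::compact_t2_space \<Rightarrow>\<^sub>C 'k::{real_normed_field, complete_space}) \<Rightarrow> 'a \<Rightarrow> 'k"
  assumes cont: "\<And>n x. continuous_on UNIV (\<Phi> n x)"
    and add: "\<And>n x y k. \<Phi> n (x + y) k = \<Phi> n x k + \<Phi> n y k"
    and scale: "\<And>n c x k. \<Phi> n (mult_bcontfun (const_bcontfun c) x) k = c * \<Phi> n x k"
    and bound: "\<And>n x k. norm (\<Phi> n x k) \<le> B * norm x"
    and cauchy: "\<And>x. uniformly_Cauchy_on UNIV (\<lambda>n. \<Phi> n x)"
  obtains S where "scalar_linear S" "\<And>x k. (\<lambda>n. \<Phi> n x k) \<longlonglongrightarrow> apply_bcontfun (blinfun_apply S x) k"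
proof -
  have "\<exists>l. uniform_limit UNIV (\<lambda>n. \<Phi> n x) l sequentially" for x
    using Cauchy_uniformly_convergent[OF cauchy] by (auto simp: uniformly_convergent_on_def)
  then obtain l where l: "\<And>x. uniform_limit UNIV (\<lambda>n. \<Phi> n x) (l x) sequentially" by metis
  have "continuous_on UNIV (l x)" for x
    by (rule uniform_limit_theorem[OF _ l]) (simp_all add: cont)
  then have app: "apply_bcontfun (Bcontfun (l x)) = l x" for x
    by (rule bcontfun_on_compact)
  have lim: "(\<lambda>n. \<Phi> n x k) \<longlonglongrightarrow> l x k" for x k
    by (rule tendsto_uniform_limitI[OF l]) simp
  have l_add: "l (x + y) k = l x k + l y k" for x y k
    using tendsto_add[OF lim[of x k] lim[of y k]] lim[of "x + y" k]
    by (simp add: add LIMSEQ_unique)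
  have l_scale: "l (mult_bcontfun (const_bcontfun c) x) k = c * l x k" for c x k
    using tendsto_mult_left[OF lim[of x k], of c] lim[of "mult_bcontfun (const_bcontfun c) x" k]
    by (simp add: scale LIMSEQ_unique)
  have l_bound: "norm (l x k) \<le> B * norm x" for x k
    by (rule LIMSEQ_le_const2[OF tendsto_norm[OF lim]]) (simp add: bound)
  have "bounded_linear (\<lambda>x. Bcontfun (l x))"
  proof (rule bounded_linear_intro[where K = B])
    show "Bcontfun (l (x + y)) = Bcontfun (l x) + Bcontfun (l y)" for x y
      by (rule bcontfun_eqI) (simp add: app l_add)
    show "Bcontfun (l (a *\<^sub>R x)) = a *\<^sub>R Bcontfun (l x)" for a x
    proof -
      have "a *\<^sub>R x = mult_bcontfun (const_bcontfun (of_real a)) x"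
        by (rule bcontfun_eqI) (simp add: scaleR_conv_of_real)
      then show ?thesis
        by (intro bcontfun_eqI) (simp add: app l_scale scaleR_conv_of_real)
    qed
    show "norm (Bcontfun (l x)) \<le> norm x * B" for x
      by (rule norm_bound) (simp add: app l_bound mult.commute)
  qed
  then have S: "blinfun_apply (Blinfun (\<lambda>x. Bcontfun (l x))) x = Bcontfun (l x)" for x
    by (simp add: bounded_linear_Blinfun_apply)
  show thesis
  proof (rule that[of "Blinfun (\<lambda>x. Bcontfun (l x))"])
    show "scalar_linear (Blinfun (\<lambda>x. Bcontfun (l x)))"
      unfolding scalar_linear_def S by (auto intro!: bcontfun_eqI simp: app l_scale)
  qed (simp add: S app lim)
qed

text \<open>The finite combination of point evaluations that a list of pieces stands for. Each set is
  represented by an arbitrary one of its points.\<close>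

definition weighted_values :: "'a piece list \<Rightarrow> ('a \<Rightarrow> 'k::real_normed_vector) \<Rightarrow> real \<Rightarrow> 'k" where
  "weighted_values L x c = (\<Sum>(\<rho>, C)\<leftarrow>L. \<rho> c *\<^sub>R x (SOME a. a \<in> C))"

lemma weighted_values_Nil [simp]: "weighted_values [] x c = 0"
  and weighted_values_Cons [simp]:
    "weighted_values ((\<rho>, C) # L) x c = \<rho> c *\<^sub>R x (SOME a. a \<in> C) + weighted_values L x c"
  by (simp_all add: weighted_values_def)

lemma weighted_values_add: "weighted_values L (\<lambda>k. x k + y k) c = weighted_values L x c + weighted_values L y c"
  by (induction L) (auto simp: algebra_simps)

lemma weighted_values_diff: "weighted_values L (\<lambda>k. x k - y k) c = weighted_values L x c - weighted_values L y c"
  by (induction L) (auto simp: algebra_simps)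

lemma weighted_values_scale:
  "weighted_values L (\<lambda>k. a * x k) c = (a :: 'k::real_normed_field) * weighted_values L x c"
  by (induction L) (auto simp: algebra_simps)

lemma continuous_on_weighted_values:
  assumes "\<forall>P\<in>set L. supported_piece r X P"
  shows "continuous_on S (weighted_values L x)"
  using assms
proof (induction L)
  case Nil
  show ?case by (simp add: weighted_values_def)
next
  case (Cons P L)
  obtain \<rho> C where P: "P = (\<rho>, C)" by (cases P)
  have "continuous_on S \<rho>"
    using Cons.prems by (auto simp: P supported_piece_def intro: continuous_on_subset)
  then have "continuous_on S (\<lambda>c. \<rho> c *\<^sub>R x (SOME a. a \<in> C) + weighted_values L x c)"
    using Cons by (intro continuous_intros) auto
  then show ?case by (simp add: P)
qed

text \<open>A weighted combination of values close to \<open>z\<close> is close to the corresponding multiple of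
  \<open>z\<close>. Only pieces with nonzero weight at the level \<open>c\<close> count.\<close>

lemma norm_weighted_values_diff_le:
  assumes "\<forall>P\<in>set L. supported_piece r X P"
    and "\<And>\<rho> C. (\<rho>, C) \<in> set L \<Longrightarrow> \<rho> c \<noteq> 0 \<Longrightarrow> norm (x (SOME a. a \<in> C) - z) \<le> \<eta>"
  shows "norm (weighted_values L x c - (\<Sum>(\<rho>, C)\<leftarrow>L. \<rho> c) *\<^sub>R z) \<le> (\<Sum>(\<rho>, C)\<leftarrow>L. \<rho> c) * \<eta>"
  using assms
proof (induction L)
  case (Cons P L)
  obtain \<rho> C where P: "P = (\<rho>, C)" by (cases P)
  let ?v = "x (SOME a. a \<in> C)" and ?s = "\<Sum>(\<rho>, C)\<leftarrow>L. \<rho> c"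
  have "0 \<le> \<rho> c" using Cons.prems(1) by (simp add: P supported_piece_def)
  then have "norm (\<rho> c *\<^sub>R (?v - z)) \<le> \<rho> c * \<eta>"
    using Cons.prems(2)[of \<rho> C] by (cases "\<rho> c = 0") (auto simp: P)
  moreover have "norm (weighted_values L x c - ?s *\<^sub>R z) \<le> ?s * \<eta>"
    by (rule Cons.IH) (use Cons.prems in auto)
  moreover have "weighted_values (P # L) x c - (\<rho> c + ?s) *\<^sub>R z
      = \<rho> c *\<^sub>R (?v - z) + (weighted_values L x c - ?s *\<^sub>R z)"
    by (simp add: P algebra_simps)
  ultimately have "norm (weighted_values (P # L) x c - (\<rho> c + ?s) *\<^sub>R z) \<le> \<rho> c * \<eta> + ?s * \<eta>"
    using norm_triangle_mono by (metis (no_types, lifting))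
  then show ?case by (simp add: P algebra_simps)
qed simp

text \<open>In direction of the difference \<open>d\<close>, both combinations compare with the upper sums of
  \<open>G C = sup (x \<bullet> d)\<close> over \<open>C\<close>, and refinement can only lower an upper sum.\<close>

lemma weighted_values_refines:
  fixes x :: "'a::metric_space \<Rightarrow> 'k::euclidean_space"
  assumes ref: "refines L' L"
    and L': "\<forall>P\<in>set L'. supported_piece r X P" and L: "\<forall>P\<in>set L. supported_piece r X P"
    and bdd: "\<And>k. norm (x k) \<le> B" and \<omega>: "0 \<le> \<omega>"
    and osc: "\<And>\<rho> C p q. (\<rho>, C) \<in> set L \<Longrightarrow> p \<in> C \<Longrightarrow> q \<in> C \<Longrightarrow> norm (x p - x q) \<le> \<omega>"
  shows "norm (weighted_values L' x c - weighted_values L x c) \<le> \<omega> * (\<Sum>(\<rho>, C)\<leftarrow>L. \<rho> c)"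
proof -
  define d where "d = weighted_values L' x c - weighted_values L x c"
  define G where "G C = (SUP k\<in>C. x k \<bullet> d)" for C
  have ub: "x k \<bullet> d \<le> B * norm d" for k
    using norm_cauchy_schwarz[of "x k" d] mult_right_mono[OF bdd[of k], of "norm d"] by simp
  have bddG: "bdd_above ((\<lambda>k. x k \<bullet> d) ` C)" for C
    using ub by (intro bdd_aboveI2)
  have G_mono: "\<forall>A B. A \<noteq> {} \<longrightarrow> A \<subseteq> B \<longrightarrow> G A \<le> G B"
    unfolding G_def by (intro allI impI cSUP_subset_mono bddG) auto
  have inner: "weighted_values M x c \<bullet> d = (\<Sum>(\<rho>, C)\<leftarrow>M. \<rho> c * (x (SOME a. a \<in> C) \<bullet> d))" for M
    by (induction M) (auto simp: inner_add_left)
  have tag: "(SOME a. a \<in> C) \<in> C" "0 \<le> \<rho> c" if "supported_piece r X (\<rho>, C)" for \<rho> C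
    using that by (auto simp: supported_piece_def patch_def some_in_eq)
  have "weighted_values L' x c \<bullet> d \<le> (\<Sum>(\<rho>, C)\<leftarrow>L'. \<rho> c * G C)"
    unfolding inner
  proof (intro sum_list_mono, clarify)
    fix \<rho> C assume "(\<rho>, C) \<in> set L'"
    then have "supported_piece r X (\<rho>, C)" using L' by auto
    from tag[OF this] show "\<rho> c * (x (SOME a. a \<in> C) \<bullet> d) \<le> \<rho> c * G C"
      unfolding G_def by (intro mult_left_mono cSUP_upper bddG)
  qed
  also have "\<dots> \<le> (\<Sum>(\<rho>, C)\<leftarrow>L. \<rho> c * G C)"
    using ref G_mono unfolding refines_def by blast
  also have "\<dots> \<le> (\<Sum>(\<rho>, C)\<leftarrow>L. \<rho> c * (x (SOME a. a \<in> C) \<bullet> d + \<omega> * norm d))"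
  proof (intro sum_list_mono, clarify)
    fix \<rho> C assume mem: "(\<rho>, C) \<in> set L"
    then have t: "(SOME a. a \<in> C) \<in> C" "0 \<le> \<rho> c" using tag[of \<rho> C] L by auto
    let ?a = "SOME a. a \<in> C"
    have "x k \<bullet> d \<le> x ?a \<bullet> d + \<omega> * norm d" if "k \<in> C" for k
    proof -
      have "(x k - x ?a) \<bullet> d \<le> norm (x k - x ?a) * norm d" by (rule norm_cauchy_schwarz)
      also have "\<dots> \<le> \<omega> * norm d" by (rule mult_right_mono[OF osc[OF mem that t(1)]]) simp
      finally show ?thesis by (simp add: inner_diff_left)
    qed
    then have "G C \<le> x ?a \<bullet> d + \<omega> * norm d"
      unfolding G_def using t(1) by (intro cSUP_least) auto
    then show "\<rho> c * G C \<le> \<rho> c * (x ?a \<bullet> d + \<omega> * norm d)"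
      using t(2) by (rule mult_left_mono)
  qed
  also have "\<dots> = weighted_values L x c \<bullet> d + \<omega> * norm d * (\<Sum>(\<rho>, C)\<leftarrow>L. \<rho> c)"
    unfolding inner by (induction L) (auto simp: algebra_simps)
  finally have "d \<bullet> d \<le> (\<omega> * (\<Sum>(\<rho>, C)\<leftarrow>L. \<rho> c)) * norm d"
    by (simp add: d_def inner_diff_left algebra_simps)
  then have *: "norm d * norm d \<le> (\<omega> * (\<Sum>(\<rho>, C)\<leftarrow>L. \<rho> c)) * norm d"
    by (simp add: dot_square_norm power2_eq_square)
  have "0 \<le> (\<Sum>(\<rho>, C)\<leftarrow>L. \<rho> c)"
    using tag(2) L by (intro sum_list_nonneg) auto
  then have "norm d \<le> \<omega> * (\<Sum>(\<rho>, C)\<leftarrow>L. \<rho> c)"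
    using * \<omega> by (cases "norm d = 0") (auto simp: mult_le_cancel_right)
  then show ?thesis by (simp add: d_def)
qed

section \<open>Transfer of values within a level\<close>

lemma supported_piece_crossed:
  "supported_piece r X (\<rho>, C) \<Longrightarrow> \<rho> c \<noteq> 0 \<Longrightarrow> c \<in> crossed r C"
  by (auto simp: supported_piece_def)

lemma apply_mult_bcontfun_fun: "apply_bcontfun (mult_bcontfun f x) = (\<lambda>t. f t * x t)"
  by (rule ext) simp

text \<open>The standing situation: multiplication by \<open>h\<close> is in the double commutant of multiplication by
  the real-valued function \<open>f\<close>.\<close>

locale real_multiplier =
  fixes f h :: "'a::{compact_t2_space, metric_space} \<Rightarrow>\<^sub>C 'k::{real_normed_field, euclidean_space}"
    and r :: "'a \<Rightarrow> real"
  assumes f_eq: "\<And>t. apply_bcontfun f t = of_real (r t)"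
    and double_commutes: "mult_op h \<in> double_commutant (mult_op f)"
begin

lemma continuous_r: "continuous_on S r"
proof -
  have "continuous_on S (\<lambda>t. norm (apply_bcontfun f t - of_real (- norm f)))"
    by (intro continuous_intros continuous_on_apply_bcontfun)
  \<comment> \<open>The shift by \<open>norm f\<close> makes the real number nonnegative, so that the norm recovers it.\<close>
  moreover have "norm (apply_bcontfun f t - of_real (- norm f)) = r t + norm f" for t
  proof -
    have "\<bar>r t\<bar> \<le> norm f" using norm_bounded[of f t] by (simp add: f_eq)
    moreover have "apply_bcontfun f t - of_real (- norm f) = of_real (r t + norm f)" by (simp add: f_eq)
    ultimately show ?thesis by (simp only: norm_of_real)
  qed
  ultimately have "continuous_on S (\<lambda>t. r t + norm f - norm f)"
    by (intro continuous_on_diff continuous_on_const) simp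
  then show ?thesis by simp
qed

text \<open>An operator that commutes with multiplication by \<open>f\<close> also commutes with multiplication by
  \<open>h\<close>; all information about \<open>h\<close> comes from applying both products to the constant
  function \<open>1\<close>.\<close>

lemma commuting_operator:
  assumes "scalar_linear S"
    and "\<And>x t. apply_bcontfun (blinfun_apply S (mult_bcontfun f x)) t = f t * apply_bcontfun (blinfun_apply S x) t"
  shows "apply_bcontfun (blinfun_apply S h) t = h t * apply_bcontfun (blinfun_apply S (const_bcontfun 1)) t"
proof -
  have "S \<in> commutant {mult_op f}"
    using assms by (simp add: commutant_def comp_mult_op_iff)
  then have "mult_op h o\<^sub>L S = S o\<^sub>L mult_op h"
    using double_commutes unfolding double_commutant_def commutant_def[of "commutant _"] by blast
  then have "S o\<^sub>L mult_op h = mult_op h o\<^sub>L S" by simp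
  from this[unfolded comp_mult_op_iff, rule_format, of "const_bcontfun 1" t]
  show ?thesis by simp
qed

text \<open>Let \<open>w\<close> be supported in a ball inside the level and \<open>v\<close> a point of the level. Then
  \<open>S x = w \<cdot> x(v)\<close> commutes with multiplication by \<open>f\<close>, because \<open>f\<close> has the value \<open>f v\<close>
  wherever \<open>w\<close> does not vanish.\<close>

lemma constant_on_plateau_level:
  assumes "plateau r c" "r s = c" "r t = c"
  shows "h s = h t"
proof -
  obtain o' where "o' \<in> interior {k. r k = c}" using assms(1) by (auto simp: plateau_def)
  then obtain e where e: "0 < e" "ball o' e \<subseteq> {k. r k = c}"
    by (auto simp: mem_interior)
  define w where "w k = (of_real (max 0 (e - dist o' k)) :: 'k)" for k
  have "h v = h o'" if "r v = c" for v
  proof -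
    define \<Phi> where "\<Phi> n x k = w k * apply_bcontfun x v" for n :: nat and x and k
    have w_cont: "continuous_on UNIV w" unfolding w_def by (intro continuous_intros)
    obtain S where S: "scalar_linear S" "\<And>x k. (\<lambda>n. \<Phi> n x k) \<longlonglongrightarrow> apply_bcontfun (blinfun_apply S x) k"
    proof (rule limit_operator[of \<Phi> e])
      show "continuous_on UNIV (\<Phi> n x)" for n x
        unfolding \<Phi>_def by (intro continuous_intros w_cont)
      show "norm (\<Phi> n x k) \<le> e * norm x" for n x k
        unfolding \<Phi>_def norm_mult using e(1) norm_bounded[of x v]
        by (intro mult_mono) (auto simp: w_def)
      show "uniformly_Cauchy_on UNIV (\<lambda>n. \<Phi> n x)" for x
        by (auto simp: uniformly_Cauchy_on_def \<Phi>_def)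
    qed (auto simp: \<Phi>_def algebra_simps)
    have S_eq: "apply_bcontfun (blinfun_apply S x) k = w k * x v" for x k
      using S(2)[of x k] by (simp add: \<Phi>_def LIMSEQ_const_iff)
    have "w k * f v = f k * w k" for k
      using e(2) that by (cases "k \<in> ball o' e") (auto simp: w_def f_eq)
    then have "apply_bcontfun (blinfun_apply S h) o' = h o' * apply_bcontfun (blinfun_apply S (const_bcontfun 1)) o'"
      by (intro commuting_operator S(1)) (simp add: S_eq mult.assoc[symmetric])
    moreover have "w o' \<noteq> 0" using e(1) by (simp add: w_def)
    ultimately show ?thesis by (simp add: S_eq)
  qed
  then show ?thesis using assms(2,3) by metis
qed

lemma crossed_attained:
  assumes "patch X C" "c \<in> crossed r C"
  obtains a where "a \<in> C" "r a = c"
proof -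
  have "c \<in> r ` C"
    using assms crossed_subset_image[of C r] continuous_r by (auto simp: patch_def)
  then show thesis using that by blast
qed

text \<open>Starting from a bump \<open>\<psi>\<close> at \<open>c\<close> on the patch \<open>C\<close>, take successive refinements with mesh
  tending to zero. The operators \<open>x \<mapsto> weighted_values (L n) x \<circ> r\<close> converge to an operator
  \<open>S\<close> that commutes with multiplication by \<open>f\<close>, since pieces that are active at level
  \<open>r t\<close> are small sets that cross this level. As \<open>S 1 = 1\<close> on the level \<open>c\<close>, the value
  \<open>h k = (S h)(k)\<close> is a limit of averages of values of \<open>h\<close> on \<open>C\<close>. The point \<open>k\<close> itself may
  lie anywhere in the space.\<close>

lemma level_transfer:
  assumes X: "tame X" and C: "patch X C" and d: "0 < d"
    and cross: "{c - d..c + d} \<subseteq> crossed r C" and np: "\<And>c'. c' \<in> {c - d..c + d} \<Longrightarrow> \<not> plateau r c'"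
    and near: "\<And>a. a \<in> C \<Longrightarrow> norm (h a - z) \<le> \<eta>" and k: "r k = c"
  shows "norm (h k - z) \<le> \<eta>"
proof -
  define \<psi> where "\<psi> c' = max 0 (1 - \<bar>c' - c\<bar> / d)" for c'
  have \<psi>: "0 \<le> \<psi> c'" "\<psi> c' \<le> 1" for c' using d by (auto simp: \<psi>_def)
  have "\<psi> c' = 0" if "c' \<notin> {c - d..c + d}" for c'
  proof -
    have "d \<le> \<bar>c' - c\<bar>" using that by auto
    then show ?thesis using d by (simp add: \<psi>_def)
  qed
  moreover have "continuous_on UNIV \<psi>"
    unfolding \<psi>_def using d by (intro continuous_intros) auto
  ultimately have start: "supported_piece r X (\<psi>, C)"
    unfolding supported_piece_def prod.case using \<psi>(1) C cross np
    by (intro conjI allI exI[of _ "{c - d..c + d}"]) auto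
  define good where "good L \<longleftrightarrow> (\<forall>P\<in>set L. supported_piece r X P \<and> snd P \<subseteq> C)" for L
  have "\<exists>L. \<forall>n. (good (L n) \<and> (n = 0 \<longrightarrow> L n = [(\<psi>, C)])) \<and>
      (mesh_le (1 / (real n + 1)) (L (Suc n)) \<and> refines (L (Suc n)) (L n))"
  proof (rule dependent_nat_choice)
    show "\<exists>L. good L \<and> (0 = (0::nat) \<longrightarrow> L = [(\<psi>, C)])"
      using start by (intro exI[of _ "[(\<psi>, C)]"]) (simp add: good_def)
    show "\<exists>L'. (good L' \<and> (Suc n = 0 \<longrightarrow> L' = [(\<psi>, C)])) \<and>
        (mesh_le (1 / (real n + 1)) L' \<and> refines L' L)"
      if "good L \<and> (n = 0 \<longrightarrow> L = [(\<psi>, C)])" for L n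
      using refine_pieces[OF X continuous_r, of "1 / (real n + 1)" L C] that by (auto simp: good_def)
  qed
  then obtain L where L: "\<And>n. good (L n)" "L 0 = [(\<psi>, C)]"
    "\<And>n. mesh_le (1 / (real n + 1)) (L (Suc n))" "\<And>n. refines (L (Suc n)) (L n)"
    by metis
  have sup: "\<forall>P\<in>set (L n). supported_piece r X P" and inC: "\<forall>P\<in>set (L n). snd P \<subseteq> C" for n
    using L(1)[of n] by (auto simp: good_def)
  have tag: "(SOME a. a \<in> D) \<in> D" if "(\<rho>, D) \<in> set (L n)" for \<rho> D n
    using that sup[of n] by (auto simp: supported_piece_def patch_def some_in_eq)
  have ref: "refines (L m) (L n)" if "n \<le> m" for m n
    using that by (induction m rule: dec_induct) (auto intro: refines_refl refines_trans L(4))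
  have weights: "(\<Sum>(\<rho>, D)\<leftarrow>L n. \<rho> c') = \<psi> c'" for n c'
    using refines_sum_weights[OF ref[of 0 n], of c'] by (simp add: L(2))
  have small_osc: "\<exists>N. \<forall>n \<rho> D p q. N \<le> n \<longrightarrow> (\<rho>, D) \<in> set (L n) \<longrightarrow> p \<in> D \<longrightarrow> q \<in> D \<longrightarrow> norm (x p - x q) \<le> \<omega>"
    if "0 < \<omega>" for \<omega> and x :: "'a \<Rightarrow>\<^sub>C 'k"
  proof -
    have "uniformly_continuous_on UNIV (apply_bcontfun x)"
      by (intro compact_uniformly_continuous compact_UNIV continuous_on_apply_bcontfun)
    then obtain \<delta> where \<delta>: "0 < \<delta>" "\<And>p q. dist p q < \<delta> \<Longrightarrow> dist (x p) (x q) < \<omega>"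
      using \<open>0 < \<omega>\<close> unfolding uniformly_continuous_on_def by (metis UNIV_I)
    obtain N where N: "1 / (real N + 1) < \<delta>"
      using \<delta>(1) nat_approx_posE by (metis add.commute of_nat_Suc)
    have "norm (x p - x q) \<le> \<omega>"
      if "Suc N \<le> n" "(\<rho>, D) \<in> set (L n)" "p \<in> D" "q \<in> D" for n \<rho> D p q
    proof -
      obtain m where m: "n = Suc m" "N \<le> m" using \<open>Suc N \<le> n\<close> by (cases n) auto
      have "dist p q \<le> 1 / (real m + 1)" using L(3)[of m] that m by (auto simp: mesh_le_def)
      also have "\<dots> \<le> 1 / (real N + 1)" using m(2) by (simp add: frac_le)
      finally have "dist p q < \<delta>" using N by simp
      from \<delta>(2)[OF this] show ?thesis by (simp add: dist_norm)
    qed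
    then show ?thesis by blast
  qed
  define \<Phi> where "\<Phi> n x k = weighted_values (L n) (apply_bcontfun x) (r k)"
    for n and x :: "'a \<Rightarrow>\<^sub>C 'k" and k
  obtain S where S: "scalar_linear S" "\<And>x k. (\<lambda>n. \<Phi> n x k) \<longlonglongrightarrow> apply_bcontfun (blinfun_apply S x) k"
  proof (rule limit_operator[of \<Phi> 1])
    show "continuous_on UNIV (\<Phi> n x)" for n x
      unfolding \<Phi>_def
      by (rule continuous_on_compose2[OF continuous_on_weighted_values[OF sup, where S = UNIV] continuous_r]) simp
    show "\<Phi> n (x + y) k = \<Phi> n x k + \<Phi> n y k" for n x y k
      by (simp add: \<Phi>_def weighted_values_add)
    show "\<Phi> n (mult_bcontfun (const_bcontfun a) x) k = a * \<Phi> n x k" for n a x k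
      by (simp add: \<Phi>_def apply_mult_bcontfun_fun weighted_values_scale)
    show "norm (\<Phi> n x k) \<le> 1 * norm x" for n x k
    proof -
      have "norm (\<Phi> n x k - \<psi> (r k) *\<^sub>R 0) \<le> \<psi> (r k) * norm x"
        unfolding \<Phi>_def weights[symmetric, of _ n]
        by (rule norm_weighted_values_diff_le[OF sup]) (simp add: norm_bounded)
      also have "\<dots> \<le> 1 * norm x" using \<psi>(2) by (intro mult_right_mono) auto
      finally show ?thesis by simp
    qed
    show "uniformly_Cauchy_on UNIV (\<lambda>n. \<Phi> n x)" for x
    proof (rule uniformly_Cauchy_onI')
      fix e :: real assume "0 < e"
      then obtain N where N: "\<And>n \<rho> D p q. N \<le> n \<Longrightarrow> (\<rho>, D) \<in> set (L n) \<Longrightarrow> p \<in> D \<Longrightarrow> q \<in> D \<Longrightarrow> norm (x p - x q) \<le> e / 2"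
        using small_osc[of "e / 2" x] by (metis half_gt_zero)
      have "dist (\<Phi> n x k) (\<Phi> m x k) < e" if "N \<le> n" "n < m" for m n k
      proof -
        have "norm (\<Phi> m x k - \<Phi> n x k) \<le> e / 2 * (\<Sum>(\<rho>, D)\<leftarrow>L n. \<rho> (r k))"
          unfolding \<Phi>_def using \<open>0 < e\<close> that
          by (intro weighted_values_refines[OF ref sup sup, of _ _ _ "norm x"] norm_bounded N) auto
        also have "\<dots> \<le> e / 2 * 1"
          unfolding weights using \<open>0 < e\<close> \<psi>(2) by (intro mult_left_mono) auto
        also have "\<dots> < e" using \<open>0 < e\<close> by simp
        finally show ?thesis by (simp add: dist_norm norm_minus_commute)
      qed
      then show "\<exists>M. \<forall>x'\<in>UNIV. \<forall>m\<ge>M. \<forall>n>m. dist (\<Phi> m x x') (\<Phi> n x x') < e" by blast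
    qed
  qed blast
  have comm: "apply_bcontfun (blinfun_apply S (mult_bcontfun f y)) t = f t * apply_bcontfun (blinfun_apply S y) t" for y t
  proof -
    have lim: "(\<lambda>n. \<Phi> n (mult_bcontfun f y) t - f t * \<Phi> n y t)
        \<longlonglongrightarrow> apply_bcontfun (blinfun_apply S (mult_bcontfun f y)) t - f t * apply_bcontfun (blinfun_apply S y) t"
      by (intro tendsto_diff tendsto_mult_left S(2))
    have "(\<lambda>n. \<Phi> n (mult_bcontfun f y) t - f t * \<Phi> n y t) \<longlonglongrightarrow> 0"
    proof (rule LIMSEQ_I)
      fix e :: real assume "0 < e"
      \<comment> \<open>The denominator is kept positive for \<open>y = 0\<close>.\<close>
      define \<omega> where "\<omega> = e / (2 * (norm y + 1))"
      have \<omega>: "0 < \<omega>" using \<open>0 < e\<close> norm_ge_zero[of y] by (simp add: \<omega>_def add_nonneg_pos)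
      obtain N where N: "\<And>n \<rho> D p q. N \<le> n \<Longrightarrow> (\<rho>, D) \<in> set (L n) \<Longrightarrow> p \<in> D \<Longrightarrow> q \<in> D \<Longrightarrow> norm (f p - f q) \<le> \<omega>"
        using small_osc[OF \<omega>, of f] by metis
      have "norm (\<Phi> n (mult_bcontfun f y) t - f t * \<Phi> n y t) < e" if n: "N \<le> n" for n
      proof -
        \<comment> \<open>The defect of commutation is the weighted combination of the values of \<open>(f - f t) * y\<close>.\<close>
        have eq: "\<Phi> n (mult_bcontfun f y) t - f t * \<Phi> n y t = weighted_values (L n) (\<lambda>k. (f k - f t) * y k) (r t)"
          unfolding \<Phi>_def weighted_values_scale[symmetric] weighted_values_diff[symmetric]
          by (simp add: apply_mult_bcontfun_fun algebra_simps)
        have "norm (weighted_values (L n) (\<lambda>k. (f k - f t) * y k) (r t) - \<psi> (r t) *\<^sub>R 0) \<le> \<psi> (r t) * (\<omega> * norm y)"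
          unfolding weights[symmetric, of _ n]
        proof (rule norm_weighted_values_diff_le[OF sup])
          fix \<rho> D assume mem: "(\<rho>, D) \<in> set (L n)" and "\<rho> (r t) \<noteq> 0"
          let ?a = "SOME a. a \<in> D"
          have "r t \<in> crossed r D"
            using supported_piece_crossed[of r X \<rho> D] sup[of n] mem \<open>\<rho> (r t) \<noteq> 0\<close> by blast
          then obtain p q where pq: "p \<in> D" "q \<in> D" "r p < r t" "r t < r q" by (auto simp: crossed_def)
          \<comment> \<open>\<open>r t\<close> lies between two values of \<open>r\<close> on the small set \<open>D\<close>, so it is close to every value there.\<close>
          have "\<bar>r ?a - r p\<bar> \<le> \<omega>" "\<bar>r ?a - r q\<bar> \<le> \<omega>"
            using N[OF n mem tag[OF mem] pq(1)] N[OF n mem tag[OF mem] pq(2)]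
            by (simp_all add: f_eq flip: of_real_diff)
          then have "norm (f ?a - f t) \<le> \<omega>"
            using pq(3,4) by (simp add: f_eq flip: of_real_diff)
          then show "norm ((f ?a - f t) * y ?a - 0) \<le> \<omega> * norm y"
            using \<omega> norm_bounded[of y ?a] by (simp add: norm_mult mult_mono)
        qed
        also have "\<dots> \<le> 1 * (\<omega> * norm y)" using \<psi>(2) \<omega> by (intro mult_right_mono) auto
        also have "\<dots> \<le> \<omega> * (norm y + 1)" using \<omega> by simp
        also have "\<dots> = e / 2" using norm_ge_zero[of y] by (simp add: \<omega>_def field_simps add_nonneg_eq_0_iff)
        also have "\<dots> < e" using \<open>0 < e\<close> by simp
        finally show ?thesis by (simp add: eq)
      qed
      then show "\<exists>no. \<forall>n\<ge>no. norm (\<Phi> n (mult_bcontfun f y) t - f t * \<Phi> n y t - 0) < e" by auto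
    qed
    from LIMSEQ_unique[OF lim this] show ?thesis by simp
  qed
  have \<psi>c: "\<psi> (r k) = 1" using k by (simp add: \<psi>_def)
  have near_n: "norm (\<Phi> n x k - \<psi> (r k) *\<^sub>R w) \<le> \<psi> (r k) * \<theta>"
    if "\<And>a. a \<in> C \<Longrightarrow> norm (x a - w) \<le> \<theta>" for n and x :: "'a \<Rightarrow>\<^sub>C 'k" and w \<theta>
    unfolding \<Phi>_def weights[symmetric, of _ n]
    by (rule norm_weighted_values_diff_le[OF sup]) (use that tag inC in fastforce)
  have "\<Phi> n (const_bcontfun 1) k = 1" for n
    using near_n[of "const_bcontfun 1" 1 0 n] \<psi>c by simp
  then have "apply_bcontfun (blinfun_apply S (const_bcontfun 1)) k = 1"
    using S(2)[of "const_bcontfun 1" k] by (simp add: LIMSEQ_const_iff)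
  then have Sh: "apply_bcontfun (blinfun_apply S h) k = h k"
    using commuting_operator[OF S(1) comm, of k] by simp
  have "(\<lambda>n. norm (\<Phi> n h k - z)) \<longlonglongrightarrow> norm (h k - z)"
    unfolding Sh[symmetric] by (intro tendsto_intros S(2))
  then show ?thesis
    using near_n[of h z \<eta>] near \<psi>c by (intro LIMSEQ_le_const2[where X = "\<lambda>n. norm (\<Phi> n h k - z)"]) auto
qed

text \<open>The transfer to all points of a level needs nearby levels free of plateaus; a plateau, on the
  other hand, gives the same conclusion directly. One of the two occurs somewhere in every
  interval of levels.\<close>

lemma dense_transfer:
  assumes X: "tame X" and C: "patch X C" and uv: "u < v" "{u<..<v} \<subseteq> crossed r C"
    and near: "\<And>a. a \<in> C \<Longrightarrow> norm (h a - z) \<le> \<eta>"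
  obtains c where "u < c" "c < v" "\<And>k. r k = c \<Longrightarrow> norm (h k - z) \<le> \<eta>"
proof (cases "\<exists>c\<in>{u<..<v}. plateau r c")
  case True
  then obtain c where c: "c \<in> {u<..<v}" "plateau r c" by blast
  have "c \<in> crossed r C" using c(1) uv(2) by blast
  then obtain a where "a \<in> C" "r a = c" by (rule crossed_attained[OF C])
  then have "norm (h k - z) \<le> \<eta>" if "r k = c" for k
    using near[of a] constant_on_plateau_level[OF c(2) that] by metis
  then show thesis using c(1) that by auto
next
  case False
  define c d where "c = (u + v) / 2" and "d = (v - u) / 4"
  have "{c - d..c + d} \<subseteq> {u<..<v}" using uv(1) by (auto simp: c_def d_def field_simps)
  moreover have "0 < d" "u < c" "c < v" using uv(1) by (simp_all add: c_def d_def)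
  ultimately show thesis
    using False uv(2) by (intro that[of c] level_transfer[OF X C _ _ _ near, of d c]) auto
qed

end

section \<open>Levels within a tame set\<close>

text \<open>The points of \<open>X\<close> with values above \<open>c\<close> form a nonempty, proper and relatively open subset.
  As \<open>X\<close> is connected, it is not relatively closed, and a limit point that it omits has value
  \<open>c\<close>.\<close>

lemma point_touched_from_above:
  fixes r :: "'a::metric_space \<Rightarrow> real"
  assumes "connected X" "continuous_on UNIV r" "s \<in> X" "r s = c" "q \<in> X" "c < r q"
  obtains e where "e \<in> X" "r e = c" "e \<in> closure {k\<in>X. c < r k}"
proof -
  let ?A = "closure {k\<in>X. c < r k}" and ?B = "{k. r k \<le> c}"
  have "closed {k. c \<le> r k}" and B: "closed ?B"
    by (intro closed_Collect_le assms(2) continuous_on_const)+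
  then have A: "?A \<subseteq> {k. c \<le> r k}" by (intro closure_minimal) auto
  have upper: "k \<in> ?A" if "k \<in> X" "c < r k" for k
    using that by (intro subsetD[OF closure_subset]) simp
  have "?A \<inter> ?B \<inter> X \<noteq> {}"
  proof
    assume "?A \<inter> ?B \<inter> X = {}"
    moreover have "X \<subseteq> ?A \<union> ?B" using upper by force
    ultimately have "?A \<inter> X = {} \<or> ?B \<inter> X = {}"
      using B by (intro connected_closedD[OF assms(1)]) auto
    moreover have "q \<in> ?A \<inter> X" "s \<in> ?B \<inter> X" using upper assms by auto
    ultimately show False by blast
  qed
  then obtain e where "e \<in> ?A" "r e \<le> c" "e \<in> X" by blast
  moreover from this A have "c \<le> r e" by auto
  ultimately show thesis by (intro that[of e]) auto
qed

context real_multiplier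
begin

text \<open>A neighbourhood of \<open>e\<close> on which \<open>h\<close> is almost constant contains a patch that crosses all
  levels slightly above that of \<open>e\<close>.\<close>

lemma patch_above:
  assumes X: "tame X" and e: "e \<in> X" "r e = c" "e \<in> closure {k\<in>X. c < r k}" and \<delta>: "0 < \<delta>"
  obtains C \<eta> where "patch X C" "e \<in> C" "0 < \<eta>" "{c<..<c + \<eta>} \<subseteq> crossed r C"
    "\<forall>a\<in>C. norm (h a - h e) \<le> \<delta>"
proof -
  let ?V = "apply_bcontfun h -` ball (h e) \<delta>"
  have V: "open ?V" "e \<in> ?V"
    using \<delta> by (auto intro!: open_vimage continuous_on_apply_bcontfun)
  have pX: "patch X X" using patch_self[OF X] e(1) by auto
  obtain C where C: "patch X C" "e \<in> C" "C \<subseteq> X \<inter> ?V"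
    by (rule patch_nbhd[OF X pX e(1) V])
  obtain W where W: "open W" "C = X \<inter> W" using C(1) by (auto simp: patch_def openin_open)
  have "W \<inter> {k\<in>X. c < r k} \<noteq> {}"
    using open_Int_closure_eq_empty[OF W(1), of "{k\<in>X. c < r k}"] e(3) C(2) W(2) by (metis IntD2 IntI empty_iff)
  then obtain q where q: "q \<in> C" "c < r q" using W(2) by auto
  show thesis
  proof (rule that[OF C(1,2)])
    show "0 < r q - c" using q(2) by simp
    show "{c<..<c + (r q - c)} \<subseteq> crossed r C"
      using C(2) e(2) q(1) by (auto simp: crossed_def)
    show "\<forall>a\<in>C. norm (h a - h e) \<le> \<delta>"
      using C(3) by (force simp: dist_norm norm_minus_commute)
  qed
qed

text \<open>Small patches around \<open>e\<close> and \<open>e'\<close> cross a common interval of levels above \<open>c\<close>. On some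
  level in it all values of \<open>h\<close> are close to \<open>h e\<close>, and one of them is close to \<open>h e'\<close>.\<close>

lemma equal_if_touched_from_above:
  assumes X: "tame X" and e: "e \<in> X" "r e = c" "e \<in> closure {k\<in>X. c < r k}"
    and Y: "tame Y" and e': "e' \<in> Y" "r e' = c" "e' \<in> closure {k\<in>Y. c < r k}"
  shows "h e = h e'"
proof -
  have "dist (h e) (h e') \<le> \<epsilon>" if "0 < \<epsilon>" for \<epsilon>
  proof -
    have "0 < \<epsilon> / 2" using that by simp
    obtain C \<eta> where C: "patch X C" "0 < \<eta>" "{c<..<c + \<eta>} \<subseteq> crossed r C"
        "\<forall>a\<in>C. norm (h a - h e) \<le> \<epsilon> / 2"
      by (rule patch_above[OF X e \<open>0 < \<epsilon> / 2\<close>])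
    obtain C' \<eta>' where C': "patch Y C'" "0 < \<eta>'" "{c<..<c + \<eta>'} \<subseteq> crossed r C'"
        "\<forall>a\<in>C'. norm (h a - h e') \<le> \<epsilon> / 2"
      by (rule patch_above[OF Y e' \<open>0 < \<epsilon> / 2\<close>])
    have "c < c + min \<eta> \<eta>'" "{c<..<c + min \<eta> \<eta>'} \<subseteq> crossed r C"
      using C(2) C'(2) by (auto intro!: subsetD[OF C(3)])
    from dense_transfer[OF X C(1) this, of "h e" "\<epsilon> / 2"] C(4)
    obtain c' where c': "c < c'" "c' < c + min \<eta> \<eta>'" "\<And>k. r k = c' \<Longrightarrow> norm (h k - h e) \<le> \<epsilon> / 2" by blast
    have "c' \<in> crossed r C'" using c'(1,2) by (intro subsetD[OF C'(3)]) auto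
    then obtain k where k: "k \<in> C'" "r k = c'" by (rule crossed_attained[OF C'(1)])
    have "dist (h k) (h e) \<le> \<epsilon> / 2" "dist (h k) (h e') \<le> \<epsilon> / 2"
      using c'(3)[OF k(2)] C'(4) k(1) by (auto simp: dist_norm)
    then show ?thesis using dist_triangle3[of "h e" "h e'" "h k"] by simp
  qed
  then show ?thesis by (metis dist_le_zero_iff field_le_epsilon add_0)
qed

text \<open>Everything said about larger values carries over to smaller ones.\<close>

lemma negated: "real_multiplier (- f) h (\<lambda>t. - r t)"
proof
  show "apply_bcontfun (- f) t = of_real (- r t)" for t by (simp add: f_eq)
  have "mult_bcontfun (- f) y = - mult_bcontfun f y" for y :: "'a \<Rightarrow>\<^sub>C 'k"
    by (rule bcontfun_eqI) simp
  then have "commutant {mult_op (- f)} = commutant {mult_op f}"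
    by (auto simp: commutant_def comp_mult_op_iff blinfun.minus_right)
  then show "mult_op h \<in> double_commutant (mult_op (- f))"
    using double_commutes by (simp add: double_commutant_def)
qed

lemma equal_if_touched_from_below:
  assumes "tame X" "e \<in> X" "r e = c" "e \<in> closure {k\<in>X. r k < c}"
    and "tame Y" "e' \<in> Y" "r e' = c" "e' \<in> closure {k\<in>Y. r k < c}"
  shows "h e = h e'"
  using assms by (intro real_multiplier.equal_if_touched_from_above[OF negated, of X e "- c" Y e']) auto

text \<open>Points of opposite kinds are compared through a point that is of both kinds.\<close>

lemma constant_on_level:
  assumes X: "tame X" and s: "s \<in> X" "r s = c" and t: "t \<in> X" "r t = c"
  shows "h s = h t"
proof (cases "plateau r c")
  case True
  then show ?thesis using constant_on_plateau_level s(2) t(2) by blast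
next
  case False
  let ?A = "closure {k\<in>X. r k < c}" and ?B = "closure {k\<in>X. c < r k}"
  have pX: "patch X X" using patch_self[OF X] s(1) by auto
  have mixed: "h p = h q" if p: "p \<in> X" "r p = c" "p \<in> ?A" and q: "q \<in> X" "r q = c" "q \<in> ?B" for p q
  proof -
    obtain e where e: "e \<in> X" "r e = c" "e \<in> ?A" "e \<in> ?B"
      by (rule two_sided_point[OF X pX continuous_r False p(1,3) q(1,3)])
    have "h p = h e" by (rule equal_if_touched_from_below[OF X p X e(1-3)])
    also have "h e = h q" by (rule equal_if_touched_from_above[OF X e(1,2,4) X q])
    finally show ?thesis .
  qed
  have "s \<in> ?A \<union> ?B" "t \<in> ?A \<union> ?B"
    using nonplateau_one_sided[OF X pX False] s(1) t(1) by auto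
  then consider "s \<in> ?A" "t \<in> ?A" | "s \<in> ?B" "t \<in> ?B" | "s \<in> ?A" "t \<in> ?B" | "s \<in> ?B" "t \<in> ?A"
    by blast
  then show ?thesis
  proof cases
    case 1
    then show ?thesis by (intro equal_if_touched_from_below[OF X s _ X t])
  next
    case 2
    then show ?thesis by (intro equal_if_touched_from_above[OF X s _ X t])
  next
    case 3
    then show ?thesis using mixed s t by blast
  next
    case 4
    then show ?thesis using mixed[of t s] s t by simp
  qed
qed

end

section \<open>Gluing two tame sets\<close>

context real_multiplier
begin

lemma continuous_from_above:
  assumes Y: "tame Y" and t: "t \<in> Y" and \<delta>: "0 < \<delta>"
  shows "\<exists>\<eta>>0. \<forall>k\<in>Y. r t < r k \<and> r k < r t + \<eta> \<longrightarrow> norm (h k - h t) \<le> \<delta>"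
proof (cases "\<exists>q\<in>Y. r t < r q")
  case True
  then obtain q where q: "q \<in> Y" "r t < r q" by blast
  have "connected Y" using Y by (simp add: tame_def)
  obtain e where e: "e \<in> Y" "r e = r t" "e \<in> closure {k\<in>Y. r t < r k}"
    by (rule point_touched_from_above[OF \<open>connected Y\<close> continuous_r t refl q])
  obtain C \<eta> where C: "patch Y C" "0 < \<eta>" "{r t<..<r t + \<eta>} \<subseteq> crossed r C"
      "\<forall>a\<in>C. norm (h a - h e) \<le> \<delta>"
    by (rule patch_above[OF Y e \<delta>])
  have "norm (h k - h t) \<le> \<delta>" if k: "k \<in> Y" "r t < r k" "r k < r t + \<eta>" for k
  proof -
    have "r k \<in> crossed r C" using k(2,3) by (intro subsetD[OF C(3)]) auto
    then obtain a where a: "a \<in> C" "r a = r k" by (rule crossed_attained[OF C(1)])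
    have "h k = h a" "h e = h t"
      using constant_on_level[OF Y, of k "r k" a] constant_on_level[OF Y e(1,2) t] a k(1) patch_subset[OF C(1)] by auto
    then show ?thesis using C(4) a(1) by auto
  qed
  then show ?thesis using C(2) by blast
next
  case False
  then show ?thesis by (intro exI[of _ 1]) auto
qed

lemma continuous_from_below:
  assumes "tame Y" "t \<in> Y" "0 < \<delta>"
  shows "\<exists>\<eta>>0. \<forall>k\<in>Y. r k < r t \<and> r t - \<eta> < r k \<longrightarrow> norm (h k - h t) \<le> \<delta>"
  using real_multiplier.continuous_from_above[OF negated assms] by (auto simp: algebra_simps)

text \<open>A point of \<open>Y\<close> whose level is close to \<open>r t\<close> may be far from \<open>t\<close>, but it shares its level
  with a point close to \<open>t\<close> or to another point of the level of \<open>t\<close>.\<close>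

lemma continuous_in_level:
  assumes Y: "tame Y" and t: "t \<in> Y" and \<delta>: "0 < \<delta>"
  obtains \<eta> where "0 < \<eta>" "\<And>k. k \<in> Y \<Longrightarrow> \<bar>r k - r t\<bar> < \<eta> \<Longrightarrow> norm (h k - h t) \<le> \<delta>"
proof -
  obtain \<eta>1 where 1: "0 < \<eta>1" "\<And>k. k \<in> Y \<Longrightarrow> r t < r k \<Longrightarrow> r k < r t + \<eta>1 \<Longrightarrow> norm (h k - h t) \<le> \<delta>"
    using continuous_from_above[OF assms] by blast
  obtain \<eta>2 where 2: "0 < \<eta>2" "\<And>k. k \<in> Y \<Longrightarrow> r k < r t \<Longrightarrow> r t - \<eta>2 < r k \<Longrightarrow> norm (h k - h t) \<le> \<delta>"
    using continuous_from_below[OF assms] by blast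
  show thesis
  proof (rule that[of "min \<eta>1 \<eta>2"])
    fix k assume k: "k \<in> Y" "\<bar>r k - r t\<bar> < min \<eta>1 \<eta>2"
    consider "r k = r t" | "r t < r k" | "r k < r t" by linarith
    then show "norm (h k - h t) \<le> \<delta>"
    proof cases
      case 1
      then show ?thesis using constant_on_level[OF Y k(1) _ t refl] \<delta> by simp
    qed (use 1 2 k in auto)
  qed (use 1 2 in auto)
qed

text \<open>If \<open>X\<close> and \<open>Y\<close> have a second common value, say above \<open>c\<close>, then both contain points of level
  \<open>c\<close> that are touched from above, and these link the two levels. If \<open>c\<close> is the only common value,
  then \<open>r e = c\<close>, since otherwise points of \<open>Y\<close> close to \<open>e\<close> would produce
  common values between \<open>c\<close> and \<open>r e\<close>; and \<open>h e = h t\<close> by approaching \<open>e\<close> from within \<open>Y\<close>.\<close>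

lemma constant_on_level_glued:
  assumes X: "tame X" and Y: "tame Y" and e: "e \<in> X" "e \<in> closure Y"
    and s: "s \<in> X" "r s = c" and t: "t \<in> Y" "r t = c"
  shows "h s = h t"
proof (cases "\<exists>p\<in>X. \<exists>q\<in>Y. r p = r q \<and> r p \<noteq> c")
  case True
  then obtain p q where pq: "p \<in> X" "q \<in> Y" "r p = r q" "r p \<noteq> c" by blast
  have conn: "connected X" "connected Y" using X Y by (auto simp: tame_def)
  have above: "h s = h t"
    if mul: "real_multiplier f' h r'" and lev: "r' s = c'" "r' t = c'" and hi: "c' < r' p" "c' < r' q"
    for f' r' c'
  proof -
    interpret neg: real_multiplier f' h r' by (fact mul)
    obtain e1 where e1: "e1 \<in> X" "r' e1 = c'" "e1 \<in> closure {k\<in>X. c' < r' k}"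
      by (rule point_touched_from_above[OF conn(1) neg.continuous_r s(1) lev(1) pq(1) hi(1)])
    obtain e2 where e2: "e2 \<in> Y" "r' e2 = c'" "e2 \<in> closure {k\<in>Y. c' < r' k}"
      by (rule point_touched_from_above[OF conn(2) neg.continuous_r t(1) lev(2) pq(2) hi(2)])
    have "h s = h e1" by (rule neg.constant_on_level[OF X s(1) lev(1) e1(1,2)])
    also have "\<dots> = h e2" by (rule neg.equal_if_touched_from_above[OF X e1 Y e2])
    also have "\<dots> = h t" by (rule neg.constant_on_level[OF Y e2(1,2) t(1) lev(2)])
    finally show ?thesis .
  qed
  show ?thesis
  proof (cases "c < r p")
    case True
    then show ?thesis using above[OF real_multiplier_axioms] s t pq by simp
  next
    case False
    then show ?thesis using above[OF negated, of "- c"] s t pq by simp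
  qed
next
  case False
  have approx: "\<exists>k\<in>Y. \<bar>r k - r e\<bar> < \<epsilon> \<and> norm (h k - h e) < \<epsilon>" if "0 < \<epsilon>" for \<epsilon>
  proof -
    let ?W = "r -` ball (r e) \<epsilon> \<inter> apply_bcontfun h -` ball (h e) \<epsilon>"
    have "open ?W" by (intro open_Int open_vimage continuous_r continuous_on_apply_bcontfun open_ball)
    moreover have "e \<in> ?W" using that by simp
    ultimately have "?W \<inter> Y \<noteq> {}"
      using open_Int_closure_eq_empty[of ?W Y] e(2) by blast
    then show ?thesis by (auto simp: dist_norm norm_minus_commute)
  qed
  have "r e = c"
  proof (rule ccontr)
    assume ne: "r e \<noteq> c"
    then have "0 < \<bar>r e - c\<bar> / 2" by simp
    from approx[OF this] obtain k where k: "k \<in> Y" "\<bar>r k - r e\<bar> < \<bar>r e - c\<bar> / 2" by blast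
    \<comment> \<open>Since \<open>r k\<close> is closer to \<open>r e\<close> than half the gap, \<open>m\<close> is a value on both sets.\<close>
    define m where "m = (c + r e) / 2"
    have im: "connected (r ` X)" "connected (r ` Y)"
      using X Y connected_continuous_image[OF continuous_r] by (auto simp: tame_def)
    have vals: "c \<in> r ` X" "r e \<in> r ` X" "c \<in> r ` Y" "r k \<in> r ` Y"
      using s t e(1) k(1) by (metis imageI)+
    have "m \<in> r ` X \<and> m \<in> r ` Y"
    proof (cases "c < r e")
      case True
      then have "c \<le> m" "m \<le> r e" "m \<le> r k" using k(2) by (auto simp: m_def abs_if split: if_splits)
      then show ?thesis
        using connectedD_interval[OF im(1), of c "r e" m] connectedD_interval[OF im(2), of c "r k" m] vals by blast
    next
      case False
      then have "m \<le> c" "r e \<le> m" "r k \<le> m" using k(2) ne by (auto simp: m_def abs_if field_simps split: if_splits)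
      then show ?thesis
        using connectedD_interval[OF im(1), of "r e" c m] connectedD_interval[OF im(2), of "r k" c m] vals by blast
    qed
    moreover have "m \<noteq> c" using ne by (simp add: m_def field_simps)
    ultimately show False using \<open>\<not> (\<exists>p\<in>X. \<exists>q\<in>Y. r p = r q \<and> r p \<noteq> c)\<close> by auto
  qed
  have "dist (h e) (h t) \<le> \<delta>" if "0 < \<delta>" for \<delta>
  proof -
    have "0 < \<delta> / 2" using that by simp
    then obtain \<eta> where \<eta>: "0 < \<eta>" "\<And>k. k \<in> Y \<Longrightarrow> \<bar>r k - r t\<bar> < \<eta> \<Longrightarrow> norm (h k - h t) \<le> \<delta> / 2"
      by (rule continuous_in_level[OF Y t(1)]) blast
    have "0 < min \<eta> (\<delta> / 2)" using \<eta>(1) that by simp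
    from approx[OF this]
    obtain k where k: "k \<in> Y" "\<bar>r k - r e\<bar> < min \<eta> (\<delta> / 2)" "norm (h k - h e) < min \<eta> (\<delta> / 2)"
      by blast
    have "dist (h k) (h t) \<le> \<delta> / 2" "dist (h k) (h e) \<le> \<delta> / 2"
      using \<eta>(2)[OF k(1)] k(2,3) \<open>r e = c\<close> t(2) by (auto simp: dist_norm)
    then show ?thesis using dist_triangle3[of "h e" "h t" "h k"] by simp
  qed
  then have "h e = h t" by (metis dist_le_zero_iff field_le_epsilon add_0)
  moreover have "h s = h e" by (rule constant_on_level[OF X s e(1) \<open>r e = c\<close>])
  ultimately show ?thesis by simp
qed

end

section \<open>From levels to the double commutant property\<close>

text \<open>With \<open>h = g \<circ> r\<close>, uniform approximation of \<open>g\<close> by polynomials on the compact set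
  \<open>range r\<close> turns into approximation of the operator in norm.\<close>

lemma double_commutant_property_if_constant_on_levels:
  assumes const: "\<And>(f :: 'a::{compact_t2_space, metric_space} \<Rightarrow>\<^sub>C 'k::{real_normed_field, euclidean_space}) h r s t.
    real_multiplier f h r \<Longrightarrow> r s = r t \<Longrightarrow> h s = h t"
  shows "double_commutant_property TYPE('a) TYPE('k)"
  unfolding double_commutant_property_def
proof (intro allI impI equalityI closed_generated_algebra_subset_double_commutant scalar_linear_mult_op subsetI)
  fix f :: "'a \<Rightarrow>\<^sub>C 'k" and T
  assume real: "\<forall>t. apply_bcontfun f t \<in> \<real>" and T: "T \<in> double_commutant (mult_op f)"
  have "\<exists>x. apply_bcontfun f t = of_real x" for t
    using real[rule_format, of t] by (elim Reals_cases) blast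
  then obtain r where f: "\<And>t. f t = of_real (r t)" by metis
  define h where "h = blinfun_apply T (const_bcontfun 1)"
  have Th: "T = mult_op h" unfolding h_def by (rule double_commutant_eq_mult_op[OF T])
  interpret real_multiplier f h r
    using f T by unfold_locales (simp_all add: Th[symmetric])
  obtain g where g: "continuous_on (range r) g" "\<forall>t. h t = g (r t)"
    by (rule factor_through_levels[OF continuous_r continuous_on_apply_bcontfun const[OF real_multiplier_axioms]])
  have comp: "compact (range r)" by (intro compact_continuous_image continuous_r compact_UNIV)
  have "\<exists>R\<in>generated_algebra (mult_op f). dist R T < e" if "0 < e" for e
  proof -
    have "0 < e / 2" using that by simp
    from Stone_Weierstrass_polynomial_function[OF comp g(1) this]
    obtain p where p: "polynomial_function p" "\<And>c. c \<in> range r \<Longrightarrow> norm (g c - p c) < e / 2" by blast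
    let ?P = "Bcontfun (\<lambda>t. p (r t))"
    have "continuous_on UNIV (\<lambda>t. p (r t))"
      by (rule continuous_on_compose2[OF continuous_on_polymonial_function[OF p(1), of UNIV] continuous_r]) simp
    then have P: "apply_bcontfun ?P t = p (r t)" for t
      by (simp add: bcontfun_on_compact)
    have "norm (?P - h) \<le> e / 2"
    proof (rule norm_bound)
      show "norm (apply_bcontfun (?P - h) t) \<le> e / 2" for t
        using p(2)[of "r t"] by (simp add: P g(2) norm_minus_commute)
    qed
    then have "dist (mult_op ?P) T < e"
      using norm_mult_op_le[of "?P - h"] that by (simp add: dist_norm Th mult_op_diff)
    then show ?thesis
      using mult_op_vector_polynomial_in_generated_algebra[OF f continuous_r p(1)] by blast
  qed
  then show "T \<in> closed_generated_algebra (mult_op f)"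
    by (simp add: closed_generated_algebra_def closure_approachable)
qed

section \<open>The rectangle with the sine curve\<close>

lemma open_subset_closure_interior: "open X \<Longrightarrow> X \<subseteq> closure (interior X)"
  by (simp add: interior_open closure_subset)

definition rectangle_part :: "rectangle_sine_space set" where
  "rectangle_part = Point ` ({-1..0} \<times> {-1..1})"

definition curve_part :: "rectangle_sine_space set" where
  "curve_part = (\<lambda>x. Point (x, sin (1 / x))) ` {0<..1}"

lemma rectangle_subset: "{-1..0} \<times> {-1..1} \<subseteq> rectangle_sine_curve"
  by (auto simp: rectangle_sine_curve_def)

lemma curve_mem: "x \<in> {0<..1} \<Longrightarrow> (x, sin (1 / x)) \<in> rectangle_sine_curve"
  by (auto simp: rectangle_sine_curve_def)

lemma rectangle_part_iff: "p \<in> rectangle_part \<longleftrightarrow> fst (point_of p) \<le> 0"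
proof
  assume "fst (point_of p) \<le> 0"
  then have "point_of p \<in> {-1..0} \<times> {-1..1}"
    using point_of[of p] by (auto simp: rectangle_sine_curve_def)
  then show "p \<in> rectangle_part"
    unfolding rectangle_part_def by (metis imageI point_of_inverse)
next
  assume "p \<in> rectangle_part"
  then show "fst (point_of p) \<le> 0"
    using rectangle_subset by (auto simp: rectangle_part_def Point_inverse)
qed

lemma curve_part_iff: "p \<in> curve_part \<longleftrightarrow> 0 < fst (point_of p)"
proof
  assume "0 < fst (point_of p)"
  then obtain x where x: "point_of p = (x, sin (1 / x))" "x \<in> {0<..1}"
    using point_of[of p] by (auto simp: rectangle_sine_curve_def)
  then have "p = Point (x, sin (1 / x))" by (simp flip: x(1) add: point_of_inverse)
  then show "p \<in> curve_part"
    unfolding curve_part_def using x(2) by (rule image_eqI)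
next
  assume "p \<in> curve_part"
  then obtain x where x: "p = Point (x, sin (1 / x))" "x \<in> {0<..1}"
    unfolding curve_part_def by blast
  then have "point_of p = (x, sin (1 / x))"
    using Point_inverse[OF curve_mem[OF x(2)]] by simp
  then show "0 < fst (point_of p)" using x(2) by simp
qed

lemma homeomorphism_rectangle_part: "homeomorphism ({-1..0} \<times> {-1..1}) rectangle_part Point point_of"
proof (rule homeomorphismI)
  show "continuous_on ({-1..0} \<times> {-1..1}) Point"
    by (rule continuous_on_subset[OF continuous_on_Point rectangle_subset])
  show "point_of ` rectangle_part \<subseteq> {-1..0} \<times> {-1..1}"
    using rectangle_subset by (auto simp: rectangle_part_def Point_inverse)
  show "point_of (Point x) = x" if "x \<in> {-1..0} \<times> {-1..1}" for x
    using that rectangle_subset by (intro Point_inverse) blast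
qed (simp_all add: rectangle_part_def continuous_on_point_of point_of_inverse)

lemma homeomorphism_curve_part:
  "homeomorphism {0<..1} curve_part (\<lambda>x. Point (x, sin (1 / x))) (\<lambda>p. fst (point_of p))"
proof -
  have "continuous_on {0<..1::real} (\<lambda>x. (x, sin (1 / x)))"
    by (intro continuous_intros) auto
  then have "continuous_on {0<..1} (\<lambda>x. Point (x, sin (1 / x)))"
    using curve_mem by (intro continuous_on_compose2[OF continuous_on_Point]) auto
  moreover have "continuous_on curve_part (\<lambda>p. fst (point_of p))"
    by (intro continuous_on_fst continuous_on_point_of)
  moreover have "fst (point_of (Point (x, sin (1 / x)))) = x" if "x \<in> {0<..1}" for x
    using curve_mem[OF that] by (simp add: Point_inverse)
  ultimately show ?thesis
    by (intro homeomorphismI) (auto simp: curve_part_def)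
qed

lemma tame_homeomorphic_convex:
  fixes S :: "'b::real_normed_vector set"
  assumes "convex S" "homeomorphism S X a b" "X \<subseteq> closure (interior X)"
  shows "tame X"
proof -
  have "connected X"
    using connected_continuous_image[OF homeomorphism_cont1[OF assms(2)] convex_connected[OF assms(1)]]
    by (simp add: homeomorphism_image1[OF assms(2)])
  moreover have "locally connected X"
  proof (rule homeomorphism_locally_imp[OF convex_imp_locally_connected[OF assms(1)] assms(2)])
    show "connected U" if "connected V" "homeomorphism V U a b" for U V
      using connected_continuous_image[OF homeomorphism_cont1[OF that(2)] that(1)]
      by (simp add: homeomorphism_image1[OF that(2)])
  qed
  ultimately show ?thesis using assms(3) by (simp add: tame_def)
qed

lemma tame_curve_part: "tame curve_part"
proof (rule tame_homeomorphic_convex[OF _ homeomorphism_curve_part])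
  have "curve_part = {p. 0 < fst (point_of p)}" by (auto simp: curve_part_iff)
  moreover have "open {p. 0 < fst (point_of p)}"
    by (intro open_Collect_less continuous_on_fst continuous_on_point_of continuous_on_const)
  ultimately show "curve_part \<subseteq> closure (interior curve_part)" by (intro open_subset_closure_interior) simp
qed simp

lemma tame_rectangle_part: "tame rectangle_part"
proof (rule tame_homeomorphic_convex[OF _ homeomorphism_rectangle_part])
  show "convex ({-1..0::real} \<times> {-1..1::real})" by (intro convex_Times) auto
  have "open {p. fst (point_of p) < 0}"
    by (intro open_Collect_less continuous_on_fst continuous_on_point_of continuous_on_const)
  then have int: "{p. fst (point_of p) < 0} \<subseteq> interior rectangle_part"
    by (intro interior_maximal) (auto simp: rectangle_part_iff)
  show "rectangle_part \<subseteq> closure (interior rectangle_part)"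
  proof
    fix p assume "p \<in> rectangle_part"
    then obtain z where z: "p = Point z" "z \<in> {-1..0} \<times> {-1..1}"
      unfolding rectangle_part_def by blast
    obtain x y where xy: "z = (x, y)" by (cases z)
    have pt: "point_of p = (x, y)"
      unfolding z(1) xy[symmetric] using z(2) rectangle_subset by (intro Point_inverse) blast
    have p: "x \<in> {-1..0}" "y \<in> {-1..1}" using z(2) xy by simp_all
    show "p \<in> closure (interior rectangle_part)"
    proof (cases "x < 0")
      case True
      then have "p \<in> interior rectangle_part" using int pt by auto
      then show ?thesis using closure_subset by blast
    next
      case False
      then have "x = 0" using p(1) by simp
      show ?thesis
        unfolding closure_approachable
      proof (intro allI impI)
        fix e :: real assume "0 < e"
        define \<delta> where "\<delta> = min 1 (e / 2)"
        have \<delta>: "0 < \<delta>" "\<delta> \<le> 1" "\<delta> < e" using \<open>0 < e\<close> by (auto simp: \<delta>_def)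
        have q: "point_of (Point (- \<delta>, y)) = (- \<delta>, y)"
          using \<delta> p(2) by (intro Point_inverse subsetD[OF rectangle_subset]) simp
        then have "Point (- \<delta>, y) \<in> interior rectangle_part" using int \<delta>(1) by auto
        moreover have "dist (Point (- \<delta>, y)) p < e"
          unfolding dist_rectangle_sine_space_def q pt \<open>x = 0\<close>
          using \<delta> by (simp add: dist_Pair_Pair)
        ultimately show "\<exists>q\<in>interior rectangle_part. dist q p < e" by blast
      qed
    qed
  qed
qed

text \<open>The zeros \<open>1 / (n \<pi>)\<close> of \<open>sin (1 / x)\<close> give points of the curve that converge to the edge of
  the rectangle.\<close>

lemma curve_part_adherent: "Point (0, 0) \<in> rectangle_part" "Point (0, 0) \<in> closure curve_part"
proof -
  show "Point (0, 0) \<in> rectangle_part"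
    unfolding rectangle_part_def by (rule imageI) simp
  have zero: "point_of (Point (0, 0)) = (0, 0)"
    by (intro Point_inverse subsetD[OF rectangle_subset]) simp
  show "Point (0, 0) \<in> closure curve_part"
    unfolding closure_approachable
  proof (intro allI impI)
    fix e :: real assume "0 < e"
    then obtain n where n: "inverse (real (Suc n)) < e" using reals_Archimedean by blast
    define x where "x = 1 / (real (Suc n) * pi)"
    have "1 \<le> pi" using pi_ge_two by simp
    then have m: "real (Suc n) \<le> real (Suc n) * pi" "1 \<le> real (Suc n) * pi"
      using mult_mono[of 1 "real (Suc n)" 1 pi] by simp_all
    have x: "x \<in> {0<..1}" using m(2) by (simp add: x_def divide_le_eq_1)
    have "x \<le> inverse (real (Suc n))"
      using m(1) by (simp add: x_def field_simps)
    then have "x < e" using n by simp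
    have "sin (1 / x) = 0" using sin_npi[of "Suc n"] by (simp add: x_def)
    then have "point_of (Point (x, sin (1 / x))) = (x, 0)"
      using Point_inverse[OF curve_mem[OF x]] by simp
    then have "dist (Point (x, sin (1 / x))) (Point (0, 0)) < e"
      using x \<open>x < e\<close> by (simp add: dist_rectangle_sine_space_def zero dist_Pair_Pair)
    moreover have "Point (x, sin (1 / x)) \<in> curve_part" using x by (simp add: curve_part_def)
    ultimately show "\<exists>q\<in>curve_part. dist q (Point (0, 0)) < e" by blast
  qed
qed

lemma rectangle_sine_space_constant_on_level:
  fixes f h :: "rectangle_sine_space \<Rightarrow>\<^sub>C 'k::{real_normed_field, euclidean_space}"
  assumes "real_multiplier f h r" "r s = r t"
  shows "h s = h t"
proof -
  interpret real_multiplier f h r by fact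
  note R = tame_rectangle_part and C = tame_curve_part
  note e = curve_part_adherent
  have cover: "p \<in> rectangle_part \<or> p \<in> curve_part" for p
    by (auto simp: rectangle_part_iff curve_part_iff)
  have "r s = r s" "r t = r s" using assms(2) by simp_all
  note levels = this
  have swapped: "h t = h s" if "t \<in> rectangle_part" "s \<in> curve_part"
    by (rule constant_on_level_glued[OF R C e that(1) levels(2) that(2) levels(1)])
  consider "s \<in> rectangle_part" "t \<in> rectangle_part" | "s \<in> curve_part" "t \<in> curve_part"
    | "s \<in> rectangle_part" "t \<in> curve_part" | "s \<in> curve_part" "t \<in> rectangle_part"
    using cover[of s] cover[of t] by blast
  then show ?thesis
  proof cases
    case 1
    show ?thesis by (rule constant_on_level[OF R 1(1) levels(1) 1(2) levels(2)])
  next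
    case 2
    show ?thesis by (rule constant_on_level[OF C 2(1) levels(1) 2(2) levels(2)])
  next
    case 3
    show ?thesis by (rule constant_on_level_glued[OF R C e 3(1) levels(1) 3(2) levels(2)])
  next
    case 4
    show ?thesis by (rule swapped[OF 4(2,1), symmetric])
  qed
qed

theorem proposition9:
  shows "double_commutant_property TYPE(rectangle_sine_space) TYPE(real) \<and>
         double_commutant_property TYPE(rectangle_sine_space) TYPE(complex)"
proof
  show "double_commutant_property TYPE(rectangle_sine_space) TYPE(real)"
    by (rule double_commutant_property_if_constant_on_levels)
       (rule rectangle_sine_space_constant_on_level)
  show "double_commutant_property TYPE(rectangle_sine_space) TYPE(complex)"
    by (rule double_commutant_property_if_constant_on_levels)
       (rule rectangle_sine_space_constant_on_level)
qed

end
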